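(* Let $n\ge 1$, let $H$ be a group and let $h\in H\setminus\{1\}$. Let $\rho:B_n\to\mathrm{Aut}(G)$ be the Artin type representation of $B_n$ associated to $(H,h)$, where $G=H_1*\dots*H_n$ is the free product of $n$ copies of $H$. Then $\rho$ is faithful (injective).
   Context: $B_n$ is the braid group on $n$ strands with standard generators $\sigma_1,\dots,\sigma_{n-1}$. Artin type representation: let $\phi_i:H\to H_i$ be the natural isomorphisms onto the $n$ copies of $H$, and $h_i=\phi_i(h)$. For $k=1,\dots,n-1$ let $\tau_k\in\mathrm{Aut}(G)$ be determined, for all $y\in H$, by $\tau_k(\phi_k(y))=h_k^{-1}\phi_{k+1}(y)h_k$, $\tau_k(\phi_{k+1}(y))=h_k\phi_k(y)h_k^{-1}$, and $\tau_k(\phi_j(y))=\phi_j(y)$ for $j\neq k,k+1$. The Artin type representation of $B_n$ associated to $(H,h)$ is the homomorphism $\rho:B_n\to\mathrm{Aut}(G)$ with $\rho(\sigma_k)=\tau_k$ for all $k$ (the product in $\mathrm{Aut}(G)$ is composition of maps). *)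

theory Defs
  imports "HOL-Algebra.Bij"
begin

section \<open>Monoids given by generators and relations\<close>

text \<open>
  Braid groups and free products are both obtained as quotients of a free monoid of words over
  an alphabet \<open>A\<close> by the least congruence containing a set \<open>R\<close> of pairs of words. If every
  letter is invertible modulo \<open>R\<close>, the quotient is a group.
\<close>

inductive_set word_cong :: "'l set \<Rightarrow> ('l list \<times> 'l list) set \<Rightarrow> ('l list \<times> 'l list) set"
  for A R where
  rel: "(u, v) \<in> R \<Longrightarrow> u \<in> lists A \<Longrightarrow> v \<in> lists A \<Longrightarrow> (u, v) \<in> word_cong A R"
| refl: "u \<in> lists A \<Longrightarrow> (u, u) \<in> word_cong A R"
| sym: "(u, v) \<in> word_cong A R \<Longrightarrow> (v, u) \<in> word_cong A R"
| trans: "(u, v) \<in> word_cong A R \<Longrightarrow> (v, w) \<in> word_cong A R \<Longrightarrow> (u, w) \<in> word_cong A R"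
| append: "(u, u') \<in> word_cong A R \<Longrightarrow> (v, v') \<in> word_cong A R \<Longrightarrow> (u @ v, u' @ v') \<in> word_cong A R"

definition word_class :: "'l set \<Rightarrow> ('l list \<times> 'l list) set \<Rightarrow> 'l list \<Rightarrow> 'l list set" where
  "word_class A R w = word_cong A R `` {w}"

definition presented_monoid :: "'l set \<Rightarrow> ('l list \<times> 'l list) set \<Rightarrow> 'l list set monoid" where
  "presented_monoid A R =
    \<lparr> carrier = lists A // word_cong A R,
      mult = (\<lambda>X Y. \<Union>u\<in>X. \<Union>v\<in>Y. word_class A R (u @ v)),
      one = word_class A R [] \<rparr>"

lemma word_cong_lists: "(u, v) \<in> word_cong A R \<Longrightarrow> u \<in> lists A \<and> v \<in> lists A"
  by (induction rule: word_cong.induct) auto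

lemma equiv_word_cong: "equiv (lists A) (word_cong A R)"
proof (rule equivI)
  show "word_cong A R \<subseteq> lists A \<times> lists A"
    using word_cong_lists by fastforce
  show "refl_on (lists A) (word_cong A R)"
    by (auto simp: refl_on_def intro: word_cong.refl)
  show "sym (word_cong A R)"
    by (auto simp: sym_def intro: word_cong.sym)
  show "trans (word_cong A R)"
    by (auto simp: trans_def intro: word_cong.trans)
qed

lemma word_class_eq: "(u, v) \<in> word_cong A R \<Longrightarrow> word_class A R u = word_class A R v"
  unfolding word_class_def by (rule equiv_class_eq[OF equiv_word_cong])

lemma word_class_self: "w \<in> lists A \<Longrightarrow> w \<in> word_class A R w"
  by (simp add: word_class_def word_cong.refl)

lemma carrier_presented_monoid:
  "carrier (presented_monoid A R) = word_class A R ` lists A"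
  by (auto simp: presented_monoid_def quotient_def word_class_def)

lemma word_class_closed:
  "w \<in> lists A \<Longrightarrow> word_class A R w \<in> carrier (presented_monoid A R)"
  by (simp add: carrier_presented_monoid)

lemma one_presented_monoid: "\<one>\<^bsub>presented_monoid A R\<^esub> = word_class A R []"
  by (simp add: presented_monoid_def)

lemma mult_presented_monoid:
  assumes "u \<in> lists A" "v \<in> lists A"
  shows "word_class A R u \<otimes>\<^bsub>presented_monoid A R\<^esub> word_class A R v = word_class A R (u @ v)"
proof -
  have *: "word_class A R (u' @ v') = word_class A R (u @ v)"
    if "u' \<in> word_class A R u" "v' \<in> word_class A R v" for u' v'
    using that word_class_eq[OF word_cong.append[of u u' A R v v']] by (simp add: word_class_def)
  have "(\<Union>u'\<in>word_class A R u. \<Union>v'\<in>word_class A R v. word_class A R (u' @ v')) =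
      (\<Union>u'\<in>word_class A R u. \<Union>v'\<in>word_class A R v. word_class A R (u @ v))"
    by (intro SUP_cong[OF HOL.refl] *)
  also have "\<dots> = word_class A R (u @ v)"
    using word_class_self[OF assms(1)] word_class_self[OF assms(2)] by blast
  finally show ?thesis by (simp add: presented_monoid_def)
qed

lemma monoid_presented_monoid: "monoid (presented_monoid A R)"
  by (rule monoidI; unfold carrier_presented_monoid; (elim imageE)?;
      simp add: one_presented_monoid mult_presented_monoid)

lemma group_presented_monoid:
  assumes inv: "\<And>l. l \<in> A \<Longrightarrow> \<exists>l'\<in>A. ([l', l], []) \<in> word_cong A R"
  shows "group (presented_monoid A R)"
proof -
  interpret monoid "presented_monoid A R" by (rule monoid_presented_monoid)
  have *: "\<exists>w'\<in>lists A. (w' @ w, []) \<in> word_cong A R" if "w \<in> lists A" for w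
    using that
  proof (induction w)
    case Nil
    show ?case by (rule bexI[of _ "[]"]) (auto intro: word_cong.refl)
  next
    case (Cons l w)
    then obtain w' where w': "w' \<in> lists A" "(w' @ w, []) \<in> word_cong A R" by auto
    obtain l' where l': "l' \<in> A" "([l', l], []) \<in> word_cong A R" using inv Cons by blast
    have "([l', l] @ w, [] @ w) \<in> word_cong A R"
      by (rule word_cong.append[OF l'(2) word_cong.refl]) (use Cons in auto)
    then have "(w' @ ([l', l] @ w), w' @ ([] @ w)) \<in> word_cong A R"
      by (rule word_cong.append[OF word_cong.refl[OF w'(1)]])
    then have "((w' @ [l']) @ (l # w), []) \<in> word_cong A R"
      using word_cong.trans[OF _ w'(2)] by simp
    then show ?case using w' l' by (intro bexI[of _ "w' @ [l']"]) auto
  qed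
  show ?thesis
  proof (rule groupI)
    fix X assume "X \<in> carrier (presented_monoid A R)"
    then obtain w where w: "w \<in> lists A" "X = word_class A R w"
      by (auto simp: carrier_presented_monoid)
    from *[OF w(1)] obtain w' where "w' \<in> lists A" "(w' @ w, []) \<in> word_cong A R" by blast
    with w show "\<exists>Y\<in>carrier (presented_monoid A R).
        Y \<otimes>\<^bsub>presented_monoid A R\<^esub> X = \<one>\<^bsub>presented_monoid A R\<^esub>"
      using word_class_eq[of "w' @ w" "[]" A R]
      by (intro bexI[of _ "word_class A R w'"])
         (simp_all add: mult_presented_monoid one_presented_monoid word_class_closed)
  qed (auto simp: m_assoc)
qed

text \<open>The universal property, in terms of the evaluation of words in a monoid \<open>M\<close>.\<close>

definition word_eval :: "('m, 'b) monoid_scheme \<Rightarrow> ('l \<Rightarrow> 'm) \<Rightarrow> 'l list \<Rightarrow> 'm" where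
  "word_eval M f w = foldr (\<lambda>l x. f l \<otimes>\<^bsub>M\<^esub> x) w \<one>\<^bsub>M\<^esub>"

lemma word_eval_simps [simp]:
  "word_eval M f [] = \<one>\<^bsub>M\<^esub>"
  "word_eval M f (l # w) = f l \<otimes>\<^bsub>M\<^esub> word_eval M f w"
  by (simp_all add: word_eval_def)

lemma presented_monoid_lift:
  assumes M: "monoid M" and f: "\<And>l. l \<in> A \<Longrightarrow> f l \<in> carrier M"
    and R: "\<And>u v. (u, v) \<in> R \<Longrightarrow> u \<in> lists A \<Longrightarrow> v \<in> lists A \<Longrightarrow> word_eval M f u = word_eval M f v"
  obtains F where "F \<in> hom (presented_monoid A R) M"
    and "\<And>l. l \<in> A \<Longrightarrow> F (word_class A R [l]) = f l"
proof -
  interpret M: monoid M by (rule M)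
  have cl: "word_eval M f w \<in> carrier M" if "w \<in> lists A" for w
    using that by (induction w) (auto intro: f)
  have app: "word_eval M f (u @ v) = word_eval M f u \<otimes>\<^bsub>M\<^esub> word_eval M f v"
    if "u \<in> lists A" "v \<in> lists A" for u v
    using that by (induction u) (auto simp: f cl M.m_assoc)
  have wd: "word_eval M f u = word_eval M f v" if "(u, v) \<in> word_cong A R" for u v
    using that
  proof (induction rule: word_cong.induct)
    case (append u u' v v')
    then show ?case using word_cong_lists by (metis app)
  qed (auto simp: R)
  define F where "F X = word_eval M f (SOME w. w \<in> X)" for X
  have F: "F (word_class A R w) = word_eval M f w" if "w \<in> lists A" for w
  proof -
    have "(SOME v. v \<in> word_class A R w) \<in> word_class A R w"
      using word_class_self[OF that] by (rule someI)
    then show ?thesis unfolding F_def using wd by (metis Image_singleton_iff word_class_def)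
  qed
  show ?thesis
  proof
    show "F \<in> hom (presented_monoid A R) M"
      by (rule homI; unfold carrier_presented_monoid; elim imageE;
          simp add: mult_presented_monoid F cl app)
    show "F (word_class A R [l]) = f l" if "l \<in> A" for l
      using that by (simp add: F f)
  qed
qed

lemma presented_monoid_hom_ext:
  assumes F: "F \<in> hom (presented_monoid A R) M" and F': "F' \<in> hom (presented_monoid A R) M"
    and one: "F \<one>\<^bsub>presented_monoid A R\<^esub> = F' \<one>\<^bsub>presented_monoid A R\<^esub>"
    and eq: "\<And>l. l \<in> A \<Longrightarrow> F (word_class A R [l]) = F' (word_class A R [l])"
    and X: "X \<in> carrier (presented_monoid A R)"
  shows "F X = F' X"
proof -
  have "F (word_class A R w) = F' (word_class A R w)" if "w \<in> lists A" for w
    using that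
  proof (induction w)
    case Nil
    then show ?case using one by (simp add: one_presented_monoid)
  next
    case (Cons l w)
    have "word_class A R (l # w) = word_class A R [l] \<otimes>\<^bsub>presented_monoid A R\<^esub> word_class A R w"
      using Cons by (simp add: mult_presented_monoid)
    then show ?case
      using Cons eq hom_mult[OF F] hom_mult[OF F'] by (simp add: word_class_closed)
  qed
  then show ?thesis using X by (auto simp: carrier_presented_monoid)
qed


section \<open>Braid groups\<close>

text \<open>
  The letter \<open>(k, True)\<close> stands for the generator \<open>\<sigma>\<^sub>k\<close> and \<open>(k, False)\<close> for its inverse.
\<close>

definition braid_letters :: "nat \<Rightarrow> (nat \<times> bool) set" where
  "braid_letters n = {1..<n} \<times> UNIV"

definition braid_relations :: "nat \<Rightarrow> ((nat \<times> bool) list \<times> (nat \<times> bool) list) set" where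
  "braid_relations n =
     {([(k, b), (k, \<not> b)], []) | k b. k \<in> {1..<n}} \<union>
     {([(i, True), (j, True), (i, True)], [(j, True), (i, True), (j, True)])
        | i j. i \<in> {1..<n} \<and> j \<in> {1..<n} \<and> j = i + 1} \<union>
     {([(i, True), (j, True)], [(j, True), (i, True)])
        | i j. i \<in> {1..<n} \<and> j \<in> {1..<n} \<and> i + 2 \<le> j}"

definition braid_group :: "nat \<Rightarrow> (nat \<times> bool) list set monoid" where
  "braid_group n = presented_monoid (braid_letters n) (braid_relations n)"

definition braid_gen :: "nat \<Rightarrow> nat \<Rightarrow> (nat \<times> bool) list set" where
  "braid_gen n k = word_class (braid_letters n) (braid_relations n) [(k, True)]"

lemma group_braid_group: "group (braid_group n)"
  unfolding braid_group_def
proof (rule group_presented_monoid)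
  fix l assume "l \<in> braid_letters n"
  then obtain k b where l: "l = (k, b)" "k \<in> {1..<n}" by (auto simp: braid_letters_def)
  have "([(k, \<not> b), (k, \<not> \<not> b)], []) \<in> braid_relations n"
    using l unfolding braid_relations_def by blast
  then show "\<exists>l'\<in>braid_letters n. ([l', l], []) \<in> word_cong (braid_letters n) (braid_relations n)"
    using l by (intro bexI[of _ "(k, \<not> b)"] word_cong.rel) (auto simp: braid_letters_def)
qed


section \<open>Free products\<close>

text \<open>
  The free product of the groups \<open>G i\<close>, for \<open>i \<in> I\<close>, is generated by the elements of the groups,
  tagged with their index to make them disjoint; the relations are the multiplication tables.
\<close>

definition free_product_relations ::
  "'i set \<Rightarrow> ('i \<Rightarrow> ('a, 'b) monoid_scheme) \<Rightarrow> (('i \<times> 'a) list \<times> ('i \<times> 'a) list) set" where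
  "free_product_relations I G =
     {([(i, x), (i, y)], [(i, x \<otimes>\<^bsub>G i\<^esub> y)]) | i x y. i \<in> I \<and> x \<in> carrier (G i) \<and> y \<in> carrier (G i)} \<union>
     {([(i, \<one>\<^bsub>G i\<^esub>)], []) | i. i \<in> I}"

definition free_product ::
  "'i set \<Rightarrow> ('i \<Rightarrow> ('a, 'b) monoid_scheme) \<Rightarrow> ('i \<times> 'a) list set monoid" where
  "free_product I G =
     presented_monoid (SIGMA i:I. carrier (G i)) (free_product_relations I G)"

definition free_product_inj ::
  "'i set \<Rightarrow> ('i \<Rightarrow> ('a, 'b) monoid_scheme) \<Rightarrow> 'i \<Rightarrow> 'a \<Rightarrow> ('i \<times> 'a) list set" where
  "free_product_inj I G i x =
     word_class (SIGMA i:I. carrier (G i)) (free_product_relations I G) [(i, x)]"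

lemma group_free_product:
  assumes "\<And>i. i \<in> I \<Longrightarrow> group (G i)"
  shows "group (free_product I G)"
  unfolding free_product_def
proof (rule group_presented_monoid)
  fix l assume "l \<in> (SIGMA i:I. carrier (G i))"
  then obtain i x where l: "l = (i, x)" "i \<in> I" "x \<in> carrier (G i)" by auto
  interpret group "G i" using assms l by blast
  let ?C = "word_cong (SIGMA i:I. carrier (G i)) (free_product_relations I G)"
  have "([(i, inv\<^bsub>G i\<^esub> x), (i, x)], [(i, inv\<^bsub>G i\<^esub> x \<otimes>\<^bsub>G i\<^esub> x)]) \<in> ?C"
    using l unfolding free_product_relations_def
    by (intro word_cong.rel) (auto intro: inv_closed)
  moreover have "([(i, inv\<^bsub>G i\<^esub> x \<otimes>\<^bsub>G i\<^esub> x)], []) \<in> ?C"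
    using l unfolding free_product_relations_def by (intro word_cong.rel) auto
  ultimately show "\<exists>l'\<in>SIGMA i:I. carrier (G i). ([l', l], []) \<in> ?C"
    using l by (intro bexI[of _ "(i, inv\<^bsub>G i\<^esub> x)"]) (auto intro: word_cong.trans)
qed


lemma free_product_inj_closed:
  "i \<in> I \<Longrightarrow> x \<in> carrier (G i) \<Longrightarrow> free_product_inj I G i x \<in> carrier (free_product I G)"
  by (simp add: free_product_inj_def free_product_def word_class_closed)

lemma free_product_inj_hom:
  assumes "i \<in> I" "group (G i)"
  shows "free_product_inj I G i \<in> hom (G i) (free_product I G)"
proof (rule homI)
  interpret group "G i" by fact
  fix x y assume xy: "x \<in> carrier (G i)" "y \<in> carrier (G i)"
  show "free_product_inj I G i x \<in> carrier (free_product I G)"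
    using assms xy by (simp add: free_product_inj_closed)
  have "([(i, x), (i, y)], [(i, x \<otimes>\<^bsub>G i\<^esub> y)])
      \<in> word_cong (SIGMA i:I. carrier (G i)) (free_product_relations I G)"
    using assms xy unfolding free_product_relations_def by (intro word_cong.rel) auto
  then show "free_product_inj I G i (x \<otimes>\<^bsub>G i\<^esub> y) =
      free_product_inj I G i x \<otimes>\<^bsub>free_product I G\<^esub> free_product_inj I G i y"
    using assms xy
    by (simp add: free_product_inj_def free_product_def mult_presented_monoid word_class_eq)
qed

lemma free_product_lift:
  assumes M: "group M" and G: "\<And>i. i \<in> I \<Longrightarrow> group (G i)"
    and f: "\<And>i. i \<in> I \<Longrightarrow> f i \<in> hom (G i) M"
  obtains F where "F \<in> hom (free_product I G) M"
    and "\<And>i x. i \<in> I \<Longrightarrow> x \<in> carrier (G i) \<Longrightarrow> F (free_product_inj I G i x) = f i x"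
proof -
  interpret M: group M by fact
  have cl: "f i x \<in> carrier M" if "i \<in> I" "x \<in> carrier (G i)" for i x
    using that f by (auto simp: hom_def)
  obtain F where F: "F \<in> hom (presented_monoid (SIGMA i:I. carrier (G i)) (free_product_relations I G)) M"
    and F': "\<And>l. l \<in> (SIGMA i:I. carrier (G i)) \<Longrightarrow>
      F (word_class (SIGMA i:I. carrier (G i)) (free_product_relations I G) [l]) = f (fst l) (snd l)"
  proof (rule presented_monoid_lift[OF M.monoid_axioms, 
      where f = "\<lambda>l. f (fst l) (snd l)" and A = "SIGMA i:I. carrier (G i)"
        and R = "free_product_relations I G"])
    fix u v assume "(u, v) \<in> free_product_relations I G"
    then show "word_eval M (\<lambda>l. f (fst l) (snd l)) u = word_eval M (\<lambda>l. f (fst l) (snd l)) v"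
      unfolding free_product_relations_def
      by (auto simp: cl hom_mult[OF f] hom_one[OF f G M] M.m_assoc[symmetric] monoid.m_closed group.is_monoid G)
  qed (auto simp: cl split: prod.splits)
  show ?thesis
    by (rule that[of F]) (use F F' in \<open>auto simp: free_product_def free_product_inj_def\<close>)
qed

lemma free_product_hom_ext:
  assumes "group M" "\<And>i. i \<in> I \<Longrightarrow> group (G i)"
    and F: "F \<in> hom (free_product I G) M" and F': "F' \<in> hom (free_product I G) M"
    and eq: "\<And>i x. i \<in> I \<Longrightarrow> x \<in> carrier (G i) \<Longrightarrow>
      F (free_product_inj I G i x) = F' (free_product_inj I G i x)"
    and X: "X \<in> carrier (free_product I G)"
  shows "F X = F' X"
proof -
  have "group (free_product I G)" by (rule group_free_product) fact
  then have "F \<one>\<^bsub>free_product I G\<^esub> = F' \<one>\<^bsub>free_product I G\<^esub>"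
    using F F' \<open>group M\<close> by (simp add: hom_one)
  then show ?thesis
    using F F' X eq unfolding free_product_def free_product_inj_def
    by (intro presented_monoid_hom_ext[of F _ _ M F' X]) auto
qed


section \<open>Artin type representations\<close>

definition free_power :: "nat \<Rightarrow> ('a, 'b) monoid_scheme \<Rightarrow> (nat \<times> 'a) list set monoid" where
  "free_power n H = free_product {1..n} (\<lambda>_. H)"

definition copy_inj :: "nat \<Rightarrow> ('a, 'b) monoid_scheme \<Rightarrow> nat \<Rightarrow> 'a \<Rightarrow> (nat \<times> 'a) list set" where
  "copy_inj n H = free_product_inj {1..n} (\<lambda>_. H)"

definition is_artin_aut ::
  "nat \<Rightarrow> ('a, 'b) monoid_scheme \<Rightarrow> 'a \<Rightarrow> nat \<Rightarrow>
   ((nat \<times> 'a) list set \<Rightarrow> (nat \<times> 'a) list set) \<Rightarrow> bool" where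
  "is_artin_aut n H h k \<tau> \<longleftrightarrow>
     (let G = free_power n H; \<phi> = copy_inj n H in
      \<tau> \<in> auto G \<and>
      (\<forall>y\<in>carrier H.
         \<tau> (\<phi> k y) = inv\<^bsub>G\<^esub> (\<phi> k h) \<otimes>\<^bsub>G\<^esub> \<phi> (k + 1) y \<otimes>\<^bsub>G\<^esub> \<phi> k h \<and>
         \<tau> (\<phi> (k + 1) y) = \<phi> k h \<otimes>\<^bsub>G\<^esub> \<phi> k y \<otimes>\<^bsub>G\<^esub> inv\<^bsub>G\<^esub> (\<phi> k h) \<and>
         (\<forall>j\<in>{1..n} - {k, k + 1}. \<tau> (\<phi> j y) = \<phi> j y)))"

text \<open>
  The automorphisms and the representation are described by the properties that determine them;
  existence and uniqueness (on the carrier, since homomorphisms are arbitrary outside it) are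
  proved below.
\<close>

definition artin_type_representation ::
  "nat \<Rightarrow> ('a, 'b) monoid_scheme \<Rightarrow> 'a \<Rightarrow>
   ((nat \<times> bool) list set \<Rightarrow> (nat \<times> 'a) list set \<Rightarrow> (nat \<times> 'a) list set) \<Rightarrow> bool" where
  "artin_type_representation n H h \<rho> \<longleftrightarrow>
     \<rho> \<in> hom (braid_group n) (AutoGroup (free_power n H)) \<and>
     (\<forall>k\<in>{1..<n}. is_artin_aut n H h k (\<rho> (braid_gen n k)))"

lemma carrier_AutoGroup: "carrier (AutoGroup G) = auto G"
  by (simp add: AutoGroup_def)

lemma mult_AutoGroup:
  "f \<in> auto G \<Longrightarrow> g \<in> auto G \<Longrightarrow> f \<otimes>\<^bsub>AutoGroup G\<^esub> g = compose (carrier G) f g"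
  by (simp add: AutoGroup_def BijGroup_def auto_def)

lemma one_AutoGroup: "\<one>\<^bsub>AutoGroup G\<^esub> = (\<lambda>x\<in>carrier G. x)"
  by (simp add: AutoGroup_def BijGroup_def)

context
  fixes n :: nat and H :: "('a, 'b) monoid_scheme" and h :: 'a
  assumes H: "group H" and h: "h \<in> carrier H"
begin

interpretation H: group H by (rule H)

private abbreviation (input) "GG \<equiv> free_power n H"
private abbreviation (input) "phi \<equiv> copy_inj n H"

interpretation G: group "free_power n H"
  unfolding free_power_def by (rule group_free_product) (rule H)

lemma copy_inj_closed [simp]: "i \<in> {1..n} \<Longrightarrow> y \<in> carrier H \<Longrightarrow> phi i y \<in> carrier GG"
  unfolding copy_inj_def free_power_def by (rule free_product_inj_closed) auto

lemma copy_inj_hom: "i \<in> {1..n} \<Longrightarrow> phi i \<in> hom H GG"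
  unfolding copy_inj_def free_power_def by (rule free_product_inj_hom) (auto intro: H)

lemma free_power_lift:
  assumes "\<And>i. i \<in> {1..n} \<Longrightarrow> f i \<in> hom H GG"
  obtains F where "F \<in> hom GG GG" "\<And>i y. i \<in> {1..n} \<Longrightarrow> y \<in> carrier H \<Longrightarrow> F (phi i y) = f i y"
  using free_product_lift[of GG "{1..n}" "\<lambda>_. H" f] assms H G.is_group
  unfolding copy_inj_def free_power_def by metis

lemma free_power_hom_ext:
  assumes "F \<in> hom GG GG" "F' \<in> hom GG GG"
    "\<And>i y. i \<in> {1..n} \<Longrightarrow> y \<in> carrier H \<Longrightarrow> F (phi i y) = F' (phi i y)" "X \<in> carrier GG"
  shows "F X = F' X"
  using free_product_hom_ext[of GG "{1..n}" "\<lambda>_. H" F F' X] assms H G.is_group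
  unfolding copy_inj_def free_power_def by metis

lemma free_power_conj_hom:
  assumes "f \<in> hom H GG" "g \<in> carrier GG"
  shows "(\<lambda>y. g \<otimes>\<^bsub>GG\<^esub> f y \<otimes>\<^bsub>GG\<^esub> inv\<^bsub>GG\<^esub> g) \<in> hom H GG"
    and "(\<lambda>y. inv\<^bsub>GG\<^esub> g \<otimes>\<^bsub>GG\<^esub> f y \<otimes>\<^bsub>GG\<^esub> g) \<in> hom H GG"
proof -
  have cl: "\<And>y. y \<in> carrier H \<Longrightarrow> f y \<in> carrier GG" using assms(1) by (auto simp: hom_def)
  have c1: "\<And>x. x \<in> carrier GG \<Longrightarrow> inv\<^bsub>GG\<^esub> g \<otimes>\<^bsub>GG\<^esub> (g \<otimes>\<^bsub>GG\<^esub> x) = x"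
    and c2: "\<And>x. x \<in> carrier GG \<Longrightarrow> g \<otimes>\<^bsub>GG\<^esub> (inv\<^bsub>GG\<^esub> g \<otimes>\<^bsub>GG\<^esub> x) = x"
    using assms(2) by (simp_all add: G.m_assoc[symmetric])
  show "(\<lambda>y. g \<otimes>\<^bsub>GG\<^esub> f y \<otimes>\<^bsub>GG\<^esub> inv\<^bsub>GG\<^esub> g) \<in> hom H GG"
    by (rule homI) (use assms cl in \<open>auto simp: hom_mult[OF assms(1)] G.m_assoc c1\<close>)
  show "(\<lambda>y. inv\<^bsub>GG\<^esub> g \<otimes>\<^bsub>GG\<^esub> f y \<otimes>\<^bsub>GG\<^esub> g) \<in> hom H GG"
    by (rule homI) (use assms cl in \<open>auto simp: hom_mult[OF assms(1)] G.m_assoc c2\<close>)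
qed

lemma free_power_hom_inv: "F \<in> hom GG GG \<Longrightarrow> x \<in> carrier GG \<Longrightarrow> F (inv\<^bsub>GG\<^esub> x) = inv\<^bsub>GG\<^esub> (F x)"
  using G.is_group by (simp add: group_hom.hom_inv group_hom_axioms_def group_hom_def)

lemma free_power_cancel:
  assumes "x \<in> carrier GG" "y \<in> carrier GG"
  shows "inv\<^bsub>GG\<^esub> x \<otimes>\<^bsub>GG\<^esub> (x \<otimes>\<^bsub>GG\<^esub> y) = y" "x \<otimes>\<^bsub>GG\<^esub> (inv\<^bsub>GG\<^esub> x \<otimes>\<^bsub>GG\<^esub> y) = y"
  using assms by (simp_all add: G.m_assoc[symmetric])

lemmas free_power_simps = free_power_cancel G.m_assoc G.inv_mult_group

lemma artin_aut_exists:
  assumes k: "k \<in> {1..<n}"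
  shows "\<exists>\<tau>. is_artin_aut n H h k \<tau>"
proof -
  have kn: "k \<in> {1..n}" "k + 1 \<in> {1..n}" "Suc k \<in> {1..n}" using k by auto
  have hk: "phi k h \<in> carrier GG" "phi (k + 1) h \<in> carrier GG" using kn h by auto
  let ?f = "\<lambda>i y. if i = k then inv\<^bsub>GG\<^esub> (phi k h) \<otimes>\<^bsub>GG\<^esub> phi (k + 1) y \<otimes>\<^bsub>GG\<^esub> phi k h
     else if i = k + 1 then phi k h \<otimes>\<^bsub>GG\<^esub> phi k y \<otimes>\<^bsub>GG\<^esub> inv\<^bsub>GG\<^esub> (phi k h) else phi i y"
  let ?g = "\<lambda>i y. if i = k
     then inv\<^bsub>GG\<^esub> (phi (k + 1) h) \<otimes>\<^bsub>GG\<^esub> phi (k + 1) y \<otimes>\<^bsub>GG\<^esub> phi (k + 1) h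
     else if i = k + 1 then phi (k + 1) h \<otimes>\<^bsub>GG\<^esub> phi k y \<otimes>\<^bsub>GG\<^esub> inv\<^bsub>GG\<^esub> (phi (k + 1) h) else phi i y"
  have f: "?f i \<in> hom H GG" if "i \<in> {1..n}" for i
    using copy_inj_hom[OF that] free_power_conj_hom(2)[OF copy_inj_hom[OF kn(2)] hk(1)] free_power_conj_hom(1)[OF copy_inj_hom[OF kn(1)] hk(1)]
    by (cases "i = k"; cases "i = k + 1") simp_all
  have g: "?g i \<in> hom H GG" if "i \<in> {1..n}" for i
    using copy_inj_hom[OF that] free_power_conj_hom(2)[OF copy_inj_hom[OF kn(2)] hk(2)] free_power_conj_hom(1)[OF copy_inj_hom[OF kn(1)] hk(2)]
    by (cases "i = k"; cases "i = k + 1") simp_all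
  obtain F where F: "F \<in> hom GG GG"
    and F': "\<And>i y. i \<in> {1..n} \<Longrightarrow> y \<in> carrier H \<Longrightarrow> F (phi i y) = ?f i y"
    by (rule free_power_lift[of ?f, OF f]) (assumption, rule that)
  obtain K where K: "K \<in> hom GG GG"
    and K': "\<And>i y. i \<in> {1..n} \<Longrightarrow> y \<in> carrier H \<Longrightarrow> K (phi i y) = ?g i y"
    by (rule free_power_lift[of ?g, OF g]) (assumption, rule that)
  have Fcl: "\<And>x. x \<in> carrier GG \<Longrightarrow> F x \<in> carrier GG" using F by (auto simp: hom_def)
  have Kcl: "\<And>x. x \<in> carrier GG \<Longrightarrow> K x \<in> carrier GG" using K by (auto simp: hom_def)
  have FK: "F (K X) = X" if "X \<in> carrier GG" for X
  proof -
    have "(F \<circ> K) X = (\<lambda>x. x) X"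
    proof (rule free_power_hom_ext[of "F \<circ> K" "\<lambda>x. x"])
      show "F \<circ> K \<in> hom GG GG" by (rule hom_compose[OF K F])
      show "(\<lambda>x. x) \<in> hom GG GG" by (auto simp: hom_def)
      show "(F \<circ> K) (phi i y) = phi i y" if "i \<in> {1..n}" "y \<in> carrier H" for i y
        using that kn hk h by (simp add: F' K' free_power_simps hom_mult[OF F] free_power_hom_inv[OF F] Fcl)
    qed fact
    then show ?thesis by simp
  qed
  have KF: "K (F X) = X" if "X \<in> carrier GG" for X
  proof -
    have "(K \<circ> F) X = (\<lambda>x. x) X"
    proof (rule free_power_hom_ext[of "K \<circ> F" "\<lambda>x. x"])
      show "K \<circ> F \<in> hom GG GG" by (rule hom_compose[OF F K])
      show "(\<lambda>x. x) \<in> hom GG GG" by (auto simp: hom_def)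
      show "(K \<circ> F) (phi i y) = phi i y" if "i \<in> {1..n}" "y \<in> carrier H" for i y
        using that kn hk h by (simp add: F' K' free_power_simps hom_mult[OF K] free_power_hom_inv[OF K] Kcl)
    qed fact
    then show ?thesis by simp
  qed
  have "bij_betw F (carrier GG) (carrier GG)"
    by (rule bij_betw_byWitness[where f' = K]) (auto simp: FK KF Fcl Kcl)
  then have "restrict F (carrier GG) \<in> auto GG"
    using F by (auto simp: auto_def Bij_def hom_def)
  then have "is_artin_aut n H h k (restrict F (carrier GG))"
    using kn by (auto simp: is_artin_aut_def Let_def F')
  then show ?thesis by blast
qed

lemma free_power_auto_eqI:
  assumes "f \<in> auto GG" "g \<in> auto GG"
    and "\<And>i y. i \<in> {1..n} \<Longrightarrow> y \<in> carrier H \<Longrightarrow> f (phi i y) = g (phi i y)"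
  shows "f = g"
proof (rule extensionalityI)
  show "f \<in> extensional (carrier GG)" "g \<in> extensional (carrier GG)"
    using assms by (auto simp: auto_def Bij_def)
  show "f x = g x" if "x \<in> carrier GG" for x
    using assms that by (intro free_power_hom_ext[of f g x]) (auto simp: auto_def)
qed

lemma artin_aut_unique:
  assumes k: "k \<in> {1..<n}" and "is_artin_aut n H h k \<tau>" "is_artin_aut n H h k \<tau>'"
  shows "\<tau> = \<tau>'"
proof (rule free_power_auto_eqI)
  show "\<tau> \<in> auto GG" "\<tau>' \<in> auto GG" using assms by (auto simp: is_artin_aut_def Let_def)
  show "\<tau> (phi i y) = \<tau>' (phi i y)" if "i \<in> {1..n}" "y \<in> carrier H" for i y
    using assms that unfolding is_artin_aut_def Let_def by (metis DiffI insertE empty_iff)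
qed

lemma artin_type_representation_exists: "\<exists>\<rho>. artin_type_representation n H h \<rho>"
proof -
  interpret A: group "AutoGroup (free_power n H)" by (rule G.AutoGroup)
  let ?A = "AutoGroup GG"
  obtain \<tau> where \<tau>: "\<And>k. k \<in> {1..<n} \<Longrightarrow> is_artin_aut n H h k (\<tau> k)"
    using artin_aut_exists by metis
  have aut: "\<tau> k \<in> auto GG" if "k \<in> {1..<n}" for k
    using \<tau>[OF that] by (simp add: is_artin_aut_def Let_def)
  then have hom: "\<tau> k \<in> hom GG GG" if "k \<in> {1..<n}" for k
    using that by (simp add: auto_def)
  then have cl: "\<tau> k x \<in> carrier GG" if "k \<in> {1..<n}" "x \<in> carrier GG" for k x
    using that by (auto simp: hom_def)
  have Acl: "\<tau> k \<in> carrier ?A" if "k \<in> {1..<n}" for k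
    using aut[OF that] by (simp add: carrier_AutoGroup)
  have val: "\<tau> k (phi i y) =
    (if i = k then inv\<^bsub>GG\<^esub> (phi k h) \<otimes>\<^bsub>GG\<^esub> phi (k + 1) y \<otimes>\<^bsub>GG\<^esub> phi k h
     else if i = k + 1 then phi k h \<otimes>\<^bsub>GG\<^esub> phi k y \<otimes>\<^bsub>GG\<^esub> inv\<^bsub>GG\<^esub> (phi k h) else phi i y)"
    if "k \<in> {1..<n}" "i \<in> {1..n}" "y \<in> carrier H" for k i y
    using \<tau>[OF that(1)] that by (auto simp: is_artin_aut_def Let_def)
  have mult: "f \<otimes>\<^bsub>?A\<^esub> g \<in> auto GG" if "f \<in> auto GG" "g \<in> auto GG" for f g
    using A.m_closed that by (simp add: carrier_AutoGroup)
  have mult_val: "(f \<otimes>\<^bsub>?A\<^esub> g) x = f (g x)"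
    if "f \<in> auto GG" "g \<in> auto GG" "x \<in> carrier GG" for f g x
    using that by (simp add: mult_AutoGroup compose_eq)
  have braid: "\<tau> i \<otimes>\<^bsub>?A\<^esub> (\<tau> (i + 1) \<otimes>\<^bsub>?A\<^esub> \<tau> i) = \<tau> (i + 1) \<otimes>\<^bsub>?A\<^esub> (\<tau> i \<otimes>\<^bsub>?A\<^esub> \<tau> (i + 1))"
    if i: "i \<in> {1..<n}" "i + 1 \<in> {1..<n}" for i
  proof (rule free_power_auto_eqI)
    fix l y assume ly: "l \<in> {1..n}" "y \<in> carrier H"
    have ii: "i \<in> {1..n}" "i + 1 \<in> {1..n}" "i + 2 \<in> {1..n}" "Suc i \<in> {1..n}" "Suc (Suc i) \<in> {1..n}"
      "Suc i \<in> {1..<n}"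
      using i by auto
    show "(\<tau> i \<otimes>\<^bsub>?A\<^esub> (\<tau> (i + 1) \<otimes>\<^bsub>?A\<^esub> \<tau> i)) (phi l y) =
      (\<tau> (i + 1) \<otimes>\<^bsub>?A\<^esub> (\<tau> i \<otimes>\<^bsub>?A\<^esub> \<tau> (i + 1))) (phi l y)"
      using i ii ly h by (simp add: mult_val aut mult cl val free_power_simps hom_mult[OF hom] free_power_hom_inv[OF hom])
  qed (use i in \<open>auto simp: aut mult\<close>)
  have comm: "\<tau> i \<otimes>\<^bsub>?A\<^esub> \<tau> j = \<tau> j \<otimes>\<^bsub>?A\<^esub> \<tau> i"
    if i: "i \<in> {1..<n}" "j \<in> {1..<n}" "i + 2 \<le> j" for i j
  proof (rule free_power_auto_eqI)
    fix l y assume ly: "l \<in> {1..n}" "y \<in> carrier H"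
    have ii: "i \<in> {1..n}" "Suc i \<in> {1..n}" "j \<in> {1..n}" "Suc j \<in> {1..n}" 
      using i by auto
    show "(\<tau> i \<otimes>\<^bsub>?A\<^esub> \<tau> j) (phi l y) = (\<tau> j \<otimes>\<^bsub>?A\<^esub> \<tau> i) (phi l y)"
      using i ii ly h by (simp add: mult_val aut mult cl val free_power_simps hom_mult[OF hom] free_power_hom_inv[OF hom])
  qed (use i in \<open>auto simp: aut mult\<close>)
  let ?f = "\<lambda>(k, b). if b then \<tau> k else inv\<^bsub>?A\<^esub> (\<tau> k)"
  obtain \<rho> where \<rho>: "\<rho> \<in> hom (braid_group n) ?A"
    and \<rho>': "\<And>l. l \<in> braid_letters n \<Longrightarrow>
      \<rho> (word_class (braid_letters n) (braid_relations n) [l]) = ?f l"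
    unfolding braid_group_def
  proof (rule presented_monoid_lift[OF A.monoid_axioms, where f = ?f])
    fix l assume "l \<in> braid_letters n"
    then show "?f l \<in> carrier ?A" by (auto simp: braid_letters_def Acl)
  next
    fix u v assume "(u, v) \<in> braid_relations n"
    then show "word_eval ?A ?f u = word_eval ?A ?f v"
      unfolding braid_relations_def using braid comm
      by (auto simp: Acl)
  qed (rule that[unfolded braid_group_def])
  have "artin_type_representation n H h \<rho>"
    unfolding artin_type_representation_def braid_gen_def
    using \<rho> \<rho>' \<tau> by (auto simp: braid_letters_def)
  then show ?thesis by blast
qed

lemma artin_type_representation_unique:
  assumes "artin_type_representation n H h \<rho>" "artin_type_representation n H h \<rho>'"
    and X: "X \<in> carrier (braid_group n)"
  shows "\<rho> X = \<rho>' X"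
proof -
  interpret A: group "AutoGroup (free_power n H)" by (rule G.AutoGroup)
  let ?A = "AutoGroup GG"
  let ?W = "word_class (braid_letters n) (braid_relations n)"
  have hom: "\<rho> \<in> hom (braid_group n) ?A" "\<rho>' \<in> hom (braid_group n) ?A"
    using assms by (auto simp: artin_type_representation_def)
  have one: "\<rho> \<one>\<^bsub>braid_group n\<^esub> = \<one>\<^bsub>?A\<^esub>" "\<rho>' \<one>\<^bsub>braid_group n\<^esub> = \<one>\<^bsub>?A\<^esub>"
    using hom group_braid_group A.is_group by (auto intro: hom_one)
  have gen: "\<rho> (?W [(k, True)]) = \<rho>' (?W [(k, True)])" if "k \<in> {1..<n}" for k
    using assms that artin_aut_unique[OF that]
    by (auto simp: artin_type_representation_def braid_gen_def)
  have inv: "f (?W [(k, False)]) = inv\<^bsub>?A\<^esub> (f (?W [(k, True)]))"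
    if k: "k \<in> {1..<n}" and f: "f \<in> hom (braid_group n) ?A" for k f
  proof -
    have cl: "?W [(k, b)] \<in> carrier (braid_group n)" for b
      using k by (auto simp: braid_group_def braid_letters_def intro: word_class_closed)
    have "([(k, False), (k, \<not> False)], []) \<in> word_cong (braid_letters n) (braid_relations n)"
      using k by (intro word_cong.rel) (auto simp: braid_letters_def braid_relations_def)
    then have "?W [(k, False)] \<otimes>\<^bsub>braid_group n\<^esub> ?W [(k, True)] = \<one>\<^bsub>braid_group n\<^esub>"
      using k by (simp add: braid_group_def mult_presented_monoid one_presented_monoid
          braid_letters_def word_class_eq)
    then have "f (?W [(k, False)]) \<otimes>\<^bsub>?A\<^esub> f (?W [(k, True)]) = \<one>\<^bsub>?A\<^esub>"
      using hom_mult[OF f cl cl] hom_one[OF f group_braid_group A.is_group] by metis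
    then show ?thesis
      using cl f by (intro A.inv_equality[symmetric]) (auto simp: hom_def)
  qed
  show ?thesis
    using hom one X unfolding braid_group_def
  proof (rule_tac presented_monoid_hom_ext)
    fix l assume "l \<in> braid_letters n"
    then obtain k b where "l = (k, b)" "k \<in> {1..<n}" by (auto simp: braid_letters_def)
    then show "\<rho> (?W [l]) = \<rho>' (?W [l])"
      using gen inv hom by (cases b) auto
  qed auto
qed

end

end

theory Submission
  imports Defs "HOL-Algebra.Generated_Groups"
begin

text \<open>
  As in Artin's combing, every element of \<open>B\<^sub>n\<close> is a product \<open>f v r\<close>, where \<open>f\<close> lies in the
  subgroup generated by the loops \<open>A\<^sub>i\<close> of the last strand around strand \<open>i\<close>, \<open>v\<close> lies in
  \<open>B\<^bsub>n-1\<^esub>\<close>, and \<open>r\<close> is one of \<open>n\<close> coset representatives. If it acts trivially, then killing the last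
  copy of \<open>H\<close> shows that \<open>r\<close> is trivial and that \<open>v\<close> acts trivially, so \<open>v = 1\<close> by induction.
  It remains to show that a nonempty reduced product of powers of the \<open>A\<^sub>i\<close> moves \<open>h\<^sub>n\<close>. Up to
  conjugation by a power of \<open>c = h\<^sub>n h\<^sub>i\<close>, the automorphism \<open>A\<^sub>i\<^sup>k\<close> fixes the copies \<open>i\<close> and \<open>n\<close> and
  conjugates each other copy by \<open>(h\<^sub>n h\<^sub>i)\<^sup>k\<close> or \<open>(h\<^sub>i h\<^sub>n)\<^sup>k\<close>. These powers are reduced words whatever the
  order of \<open>h\<close> is, so the leading syllable of the conjugator \<open>w\<close> in \<open>w\<^sup>-\<^sup>1 h\<^sub>n w\<close>, the image of \<open>h\<^sub>n\<close>,
  records the index \<open>i\<close> of the last power applied (a ping-pong argument). Everything happens inside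
  the subgroup generated by the copies of the centralizer of \<open>h\<close>, so \<open>h\<close> may be assumed central.
\<close>

section \<open>Identities in groups\<close>

context group begin

lemma inv_cancel_left [simp]:
  "x \<in> carrier G \<Longrightarrow> y \<in> carrier G \<Longrightarrow> inv x \<otimes> (x \<otimes> y) = y"
  "x \<in> carrier G \<Longrightarrow> y \<in> carrier G \<Longrightarrow> x \<otimes> (inv x \<otimes> y) = y"
  by (simp_all add: m_assoc[symmetric])

lemma commute_inv:
  assumes "x \<otimes> y = y \<otimes> x" "x \<in> carrier G" "y \<in> carrier G"
  shows "inv x \<otimes> y = y \<otimes> inv x"
  using assms by (metis inv_solve_left inv_solve_right m_assoc m_closed inv_closed)

text \<open>Lets an inverse generator be moved through a neighbouring one. The braid relation is
  symmetric in \<open>s\<close> and \<open>t\<close>, so the lemma is also applied with the two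
  exchanged.\<close>

lemma braid_inv_conj:
  assumes "s \<otimes> t \<otimes> s = t \<otimes> s \<otimes> t" and c: "s \<in> carrier G" "t \<in> carrier G"
  shows "inv t \<otimes> s \<otimes> t = s \<otimes> t \<otimes> inv s"
proof -
  have "t \<otimes> (s \<otimes> t \<otimes> inv s) = (t \<otimes> s \<otimes> t) \<otimes> inv s" using c by (simp add: m_assoc)
  also have "\<dots> = s \<otimes> t" unfolding assms(1)[symmetric] using c by (simp add: m_assoc)
  finally show ?thesis using c by (metis inv_cancel_left(1) m_assoc m_closed inv_closed)
qed

text \<open>Both sides are the full twist (st)^3 = (ts)^3 on three strands. Here
  \<open>t \<otimes> t\<close> stands for the shortest loop, as in \<open>loop_end\<close>.\<close>

lemma type_B_relation_base:
  assumes b: "s \<otimes> t \<otimes> s = t \<otimes> s \<otimes> t" and c: "s \<in> carrier G" "t \<in> carrier G"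
  shows "s \<otimes> (t \<otimes> t) \<otimes> s \<otimes> (t \<otimes> t) = (t \<otimes> t) \<otimes> s \<otimes> (t \<otimes> t) \<otimes> s"
proof -
  have b': "s \<otimes> (t \<otimes> (s \<otimes> x)) = t \<otimes> (s \<otimes> (t \<otimes> x))" if "x \<in> carrier G" for x
    using b c that by (metis m_assoc m_closed)
  have b'': "s \<otimes> (t \<otimes> s) = t \<otimes> (s \<otimes> t)"
    using b c by (simp add: m_assoc)
  have "t \<otimes> (t \<otimes> (s \<otimes> (t \<otimes> (t \<otimes> s)))) = t \<otimes> (s \<otimes> (t \<otimes> (s \<otimes> (t \<otimes> s))))"
    using c by (simp add: b')
  also have "\<dots> = s \<otimes> (t \<otimes> (s \<otimes> (s \<otimes> (t \<otimes> s))))"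
    using c by (simp add: b')
  also have "\<dots> = s \<otimes> (t \<otimes> (s \<otimes> (t \<otimes> (s \<otimes> t))))"
    using c by (simp add: b'')
  also have "\<dots> = s \<otimes> (t \<otimes> (t \<otimes> (s \<otimes> (t \<otimes> t))))"
    using c by (simp add: b')
  finally show ?thesis using c by (simp add: m_assoc)
qed

text \<open>Carries the length-four relation down by one index: if \<open>s\<close>,
  \<open>t\<close> are the generators of index i, i+1 and \<open>a\<close> is the loop at i+2, then
  \<open>a'\<close> is the loop at i+1.\<close>

lemma type_B_relation_step:
  assumes b: "s \<otimes> t \<otimes> s = t \<otimes> s \<otimes> t"
    and B: "t \<otimes> a \<otimes> t \<otimes> a = a \<otimes> t \<otimes> a \<otimes> t" and sa: "s \<otimes> a = a \<otimes> s"
    and c: "s \<in> carrier G" "t \<in> carrier G" "a \<in> carrier G"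
  defines "a' \<equiv> t \<otimes> a \<otimes> inv t"
  shows "s \<otimes> a' \<otimes> s \<otimes> a' = a' \<otimes> s \<otimes> a' \<otimes> s"
proof -
  have b': "s \<otimes> (t \<otimes> (s \<otimes> x)) = t \<otimes> (s \<otimes> (t \<otimes> x))" if "x \<in> carrier G" for x
    using b c that by (metis m_assoc m_closed)
  have sa': "a \<otimes> (s \<otimes> x) = s \<otimes> (a \<otimes> x)" "inv s \<otimes> (a \<otimes> x) = a \<otimes> (inv s \<otimes> x)"
    if "x \<in> carrier G" for x
    using sa commute_inv[OF sa] c that by (metis m_assoc m_closed inv_closed)+
  have B': "t \<otimes> (a \<otimes> (t \<otimes> (a \<otimes> x))) = a \<otimes> (t \<otimes> (a \<otimes> (t \<otimes> x)))" if "x \<in> carrier G" for x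
  proof -
    have "t \<otimes> (a \<otimes> (t \<otimes> (a \<otimes> x))) = (t \<otimes> a \<otimes> t \<otimes> a) \<otimes> x" using c that by (simp add: m_assoc)
    also have "\<dots> = a \<otimes> (t \<otimes> (a \<otimes> (t \<otimes> x)))" unfolding B using c that by (simp add: m_assoc)
    finally show ?thesis .
  qed
  have k: "inv t \<otimes> (s \<otimes> (t \<otimes> x)) = s \<otimes> (t \<otimes> (inv s \<otimes> x))" if "x \<in> carrier G" for x
  proof -
    have "inv t \<otimes> (s \<otimes> (t \<otimes> x)) = (inv t \<otimes> s \<otimes> t) \<otimes> x" using c that by (simp add: m_assoc)
    also have "\<dots> = s \<otimes> (t \<otimes> (inv s \<otimes> x))"
      unfolding braid_inv_conj[OF b c(1,2)] using c that by (simp add: m_assoc)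
    finally show ?thesis .
  qed
  have "inv s \<otimes> t \<otimes> s = t \<otimes> s \<otimes> inv t"
    using b c by (intro braid_inv_conj) auto
  then have "inv (inv s \<otimes> t \<otimes> s) = inv (t \<otimes> s \<otimes> inv t)" by simp
  then have k2: "inv s \<otimes> (inv t \<otimes> s) = t \<otimes> (inv s \<otimes> inv t)"
    using c by (simp add: inv_mult_group m_assoc)
  have "s \<otimes> a' \<otimes> s \<otimes> a' = s \<otimes> (t \<otimes> (a \<otimes> (inv t \<otimes> (s \<otimes> (t \<otimes> (a \<otimes> inv t))))))"
    unfolding a'_def using c by (simp add: m_assoc)
  also have "\<dots> = s \<otimes> (t \<otimes> (s \<otimes> (a \<otimes> (t \<otimes> (a \<otimes> (inv s \<otimes> inv t))))))"
    using c by (simp add: k sa')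
  also have "\<dots> = t \<otimes> (s \<otimes> (t \<otimes> (a \<otimes> (t \<otimes> (a \<otimes> (inv s \<otimes> inv t))))))"
    using c by (simp add: b')
  \<comment> \<open>The relation between \<open>t\<close> and \<open>a\<close> enters only here; the
    other steps move \<open>s\<close> and its inverse across \<open>t\<close> and
    \<open>a\<close>.\<close>
  also have "\<dots> = t \<otimes> (s \<otimes> (a \<otimes> (t \<otimes> (a \<otimes> (t \<otimes> (inv s \<otimes> inv t))))))"
    using c by (simp only: B' m_closed inv_closed)
  also have "\<dots> = t \<otimes> (s \<otimes> (a \<otimes> (t \<otimes> (a \<otimes> (inv s \<otimes> (inv t \<otimes> s))))))"
    by (simp only: k2)
  also have "\<dots> = t \<otimes> (a \<otimes> (inv t \<otimes> (s \<otimes> (t \<otimes> (a \<otimes> (inv t \<otimes> s))))))"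
    using c by (simp add: k sa')
  also have "\<dots> = a' \<otimes> s \<otimes> a' \<otimes> s"
    unfolding a'_def using c by (simp add: m_assoc)
  finally show ?thesis .
qed

text \<open>Conjugation by \<open>s \<otimes> t\<close> carries \<open>s\<close> to
  \<open>t\<close>, so the commutation of \<open>s\<close> with \<open>a\<close> becomes that of
  \<open>t\<close> with \<open>a'\<close>.\<close>

lemma braid_commute_step:
  assumes b: "s \<otimes> t \<otimes> s = t \<otimes> s \<otimes> t" and sa: "s \<otimes> a = a \<otimes> s"
    and c: "s \<in> carrier G" "t \<in> carrier G" "a \<in> carrier G"
  defines "a' \<equiv> s \<otimes> (t \<otimes> a \<otimes> inv t) \<otimes> inv s"
  shows "t \<otimes> a' = a' \<otimes> t"
proof -
  have b': "s \<otimes> (t \<otimes> (s \<otimes> x)) = t \<otimes> (s \<otimes> (t \<otimes> x))" if "x \<in> carrier G" for x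
    using b c that by (metis m_assoc m_closed)
  have sa': "a \<otimes> (s \<otimes> x) = s \<otimes> (a \<otimes> x)" if "x \<in> carrier G" for x
    using sa c that by (metis m_assoc m_closed)
  have "inv t \<otimes> s \<otimes> t = s \<otimes> t \<otimes> inv s" by (rule braid_inv_conj[OF b c(1,2)])
  then have "inv (inv t \<otimes> s \<otimes> t) = inv (s \<otimes> t \<otimes> inv s)" by simp
  then have k: "inv t \<otimes> (inv s \<otimes> t) = s \<otimes> (inv t \<otimes> inv s)"
    using c by (simp add: inv_mult_group m_assoc)
  have "a' \<otimes> t = s \<otimes> (t \<otimes> (a \<otimes> (s \<otimes> (inv t \<otimes> inv s))))"
    unfolding a'_def using c by (simp add: m_assoc k)
  also have "\<dots> = t \<otimes> (s \<otimes> (t \<otimes> (a \<otimes> (inv t \<otimes> inv s))))"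
    using c by (simp add: sa' b')
  finally show ?thesis unfolding a'_def using c by (simp add: m_assoc)
qed

text \<open>Obtained by squaring \<open>braid_inv_conj\<close>. In \<open>rep_square\<close> it
  trades the square of one generator for the square of the next.\<close>

lemma braid_square_conj:
  assumes b: "s \<otimes> t \<otimes> s = t \<otimes> s \<otimes> t" and c: "s \<in> carrier G" "t \<in> carrier G"
  shows "inv t \<otimes> (s \<otimes> s) = s \<otimes> (t \<otimes> t) \<otimes> inv s \<otimes> inv t"
proof -
  have "(inv t \<otimes> s \<otimes> t) \<otimes> (inv t \<otimes> s \<otimes> t) = (s \<otimes> t \<otimes> inv s) \<otimes> (s \<otimes> t \<otimes> inv s)"
    by (simp add: braid_inv_conj[OF b c])
  then have "inv t \<otimes> (s \<otimes> (s \<otimes> t)) = s \<otimes> (t \<otimes> (t \<otimes> inv s))" using c by (simp add: m_assoc)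
  then have "(inv t \<otimes> (s \<otimes> (s \<otimes> t))) \<otimes> inv t = s \<otimes> (t \<otimes> (t \<otimes> inv s)) \<otimes> inv t" by simp
  then show ?thesis using c by (simp add: m_assoc)
qed
end

section \<open>Combing of braids\<close>

text \<open>Only relations are assumed: combing rewrites elements as products and never has to tell
  two of them apart. Distinguishing elements is left to the action.\<close>

locale braid_generators = group B for B (structure) +
  fixes N :: nat and s :: "nat \<Rightarrow> 'a"
  assumes s_closed [simp]: "k \<in> {1..<N} \<Longrightarrow> s k \<in> carrier B"
    and s_braid: "k \<in> {1..<N} \<Longrightarrow> Suc k \<in> {1..<N} \<Longrightarrow>
      s k \<otimes> s (Suc k) \<otimes> s k = s (Suc k) \<otimes> s k \<otimes> s (Suc k)"
    and s_commute: "i \<in> {1..<N} \<Longrightarrow> j \<in> {1..<N} \<Longrightarrow> i + 2 \<le> j \<Longrightarrow> s i \<otimes> s j = s j \<otimes> s i"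
begin

lemma s_far_commute:
  assumes "i \<in> {1..<N}" "j \<in> {1..<N}" "i + 2 \<le> j \<or> j + 2 \<le> i"
  shows "s i \<otimes> s j = s j \<otimes> s i"
  using assms s_commute[of i j] s_commute[of j i] by auto

text \<open>Plays the part of the braid group on the first \<open>n\<close> strands inside the one
  on \<open>N\<close> strands.\<close>

definition sub :: "nat \<Rightarrow> 'a set" where
  "sub n = generate B (s ` {1..<n})"

text \<open>
  \<open>loop n i\<close> is \<open>s\<^sub>i \<dots> s\<^bsub>n-2\<^esub> s\<^bsub>n-1\<^esub>\<^sup>2 s\<^bsub>n-2\<^esub>\<^sup>-\<^sup>1 \<dots> s\<^sub>i\<^sup>-\<^sup>1\<close>. The signs in \<open>rep n i\<close>, which is
  \<open>s\<^bsub>n-1\<^esub>\<^sup>-\<^sup>1 \<dots> s\<^sub>i\<^sup>-\<^sup>1\<close>, are forced by this choice: otherwise \<open>rep_square\<close> below fails.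
\<close>

function loop :: "nat \<Rightarrow> nat \<Rightarrow> 'a" where
  "loop n i = (if Suc i < n then s i \<otimes> loop n (Suc i) \<otimes> inv (s i) else s i \<otimes> s i)"
  by auto
termination by (relation "measure (\<lambda>(n, i). n - i)") auto

function rep :: "nat \<Rightarrow> nat \<Rightarrow> 'a" where
  "rep n i = (if i < n then rep n (Suc i) \<otimes> inv (s i) else \<one>)"
  by auto
termination by (relation "measure (\<lambda>(n, i). n - i)") auto

declare loop.simps [simp del] rep.simps [simp del]

lemma rep_step: "i < n \<Longrightarrow> rep n i = rep n (Suc i) \<otimes> inv (s i)"
  and rep_end [simp]: "rep n n = \<one>"
  and loop_step: "Suc i < n \<Longrightarrow> loop n i = s i \<otimes> loop n (Suc i) \<otimes> inv (s i)"
  and loop_end: "loop (Suc i) i = s i \<otimes> s i"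
  by (subst rep.simps loop.simps; simp)+

lemma loop_closed [simp]: "i \<in> {1..<n} \<Longrightarrow> n \<le> N \<Longrightarrow> loop n i \<in> carrier B"
proof (induction n i rule: loop.induct)
  case (1 n i)
  then show ?case by (subst loop.simps) (auto split: if_splits)
qed

lemma rep_closed [simp]: "1 \<le> i \<Longrightarrow> n \<le> N \<Longrightarrow> rep n i \<in> carrier B"
proof (induction n i rule: rep.induct)
  case (1 n i)
  then show ?case by (subst rep.simps) (auto split: if_splits)
qed

section \<open>Commutation of generators with loops and coset representatives\<close>

lemma mult_commute:
  assumes "x \<otimes> a = a \<otimes> x" "x \<otimes> b = b \<otimes> x" "x \<in> carrier B" "a \<in> carrier B" "b \<in> carrier B"
  shows "x \<otimes> (a \<otimes> b) = (a \<otimes> b) \<otimes> x"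
proof -
  have "x \<otimes> (a \<otimes> b) = (x \<otimes> a) \<otimes> b" using assms(3-5) by (simp add: m_assoc)
  also have "\<dots> = a \<otimes> (x \<otimes> b)" using assms(3-5) unfolding assms(1) by (simp add: m_assoc)
  also have "\<dots> = (a \<otimes> b) \<otimes> x" using assms(3-5) unfolding assms(2) by (simp add: m_assoc)
  finally show ?thesis .
qed

lemma conj_commute:
  assumes "x \<otimes> a = a \<otimes> x" "x \<otimes> b = b \<otimes> x" "x \<in> carrier B" "a \<in> carrier B" "b \<in> carrier B"
  shows "x \<otimes> (a \<otimes> b \<otimes> inv a) = (a \<otimes> b \<otimes> inv a) \<otimes> x"
  using assms commute_inv[of a x] by (intro mult_commute) simp_all

text \<open>\<open>loop n i\<close> is a word in generators of index at least \<open>i\<close>, and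
  all of these commute with \<open>s k\<close>.\<close>

lemma s_loop_below:
  assumes "k \<in> {1..<N}" "i \<in> {1..<n}" "n \<le> N" "Suc k < i"
  shows "s k \<otimes> loop n i = loop n i \<otimes> s k"
  using assms
proof (induction n i rule: loop.induct)
  case (1 n i)
  have c: "s k \<otimes> s i = s i \<otimes> s k" using 1 by (intro s_far_commute) auto
  show ?case
  proof (cases "Suc i < n")
    case True
    then have "s k \<otimes> loop n (Suc i) = loop n (Suc i) \<otimes> s k" using 1 by auto
    then show ?thesis using True c 1 by (simp add: loop_step) (intro conj_commute; simp)
  next
    case False
    then have "n = Suc i" using 1 by auto
    then show ?thesis using c 1 by (simp add: loop_end) (intro mult_commute; simp)
  qed
qed

text \<open>Raising \<open>i\<close> by one at a time, the induction reaches
  \<open>k = Suc i\<close>. There \<open>loop n i\<close> is the conjugate by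
  \<open>s i \<otimes> s k\<close> of a loop commuting with \<open>s i\<close>, and
  \<open>braid_commute_step\<close> applies.\<close>

lemma s_loop_above:
  assumes "k \<in> {1..<N}" "i \<in> {1..<n}" "n \<le> N" "i < k" "Suc k < n"
  shows "s k \<otimes> loop n i = loop n i \<otimes> s k"
  using assms
proof (induction n i rule: loop.induct)
  case (1 n i)
  show ?case
  proof (cases "k = Suc i")
    case True
    have "s (Suc i) \<otimes> (s i \<otimes> (s (Suc i) \<otimes> loop n (Suc (Suc i)) \<otimes> inv (s (Suc i))) \<otimes> inv (s i)) =
       (s i \<otimes> (s (Suc i) \<otimes> loop n (Suc (Suc i)) \<otimes> inv (s (Suc i))) \<otimes> inv (s i)) \<otimes> s (Suc i)"
      using 1 True by (intro braid_commute_step s_braid s_loop_below) auto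
    then show ?thesis using 1 True by (simp add: loop_step)
  next
    case False
    have "s k \<otimes> loop n (Suc i) = loop n (Suc i) \<otimes> s k" using 1 False by auto
    moreover have "s k \<otimes> s i = s i \<otimes> s k" using 1 False by (intro s_far_commute) auto
    ultimately show ?thesis using 1 by (simp add: loop_step[of i]) (intro conj_commute; simp)
  qed
qed

text \<open>Equivalent to \<open>s i\<close> commuting with
  \<open>loop n (Suc i) \<otimes> loop n i\<close>, because the second factor is the conjugate of
  the first by \<open>s i\<close>. It is used in this form in \<open>s_conj_loop\<close>.\<close>

lemma s_loop_type_B:
  assumes "1 \<le> i" "Suc i < n" "n \<le> N"
  shows "s i \<otimes> loop n (Suc i) \<otimes> s i \<otimes> loop n (Suc i) = loop n (Suc i) \<otimes> s i \<otimes> loop n (Suc i) \<otimes> s i"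
  using assms
proof (induction n i rule: loop.induct)
  case (1 n i)
  show ?case
  proof (cases "Suc (Suc i) < n")
    case True
    then show ?thesis
      using 1 s_loop_below[of i "Suc (Suc i)" n]
      by (simp add: loop_step[of "Suc i"]) (intro type_B_relation_step s_braid; simp)
  next
    case False
    then have "n = Suc (Suc i)" using 1 by auto
    then show ?thesis using 1 by (simp add: loop_end type_B_relation_base s_braid)
  qed
qed

lemma s_rep_below:
  assumes "1 \<le> k" "Suc k < i" "i \<le> n" "n \<le> N"
  shows "s k \<otimes> rep n i = rep n i \<otimes> s k"
  using assms
proof (induction n i rule: rep.induct)
  case (1 n i)
  show ?case
  proof (cases "i < n")
    case True
    have "s i \<otimes> s k = s k \<otimes> s i" using 1 True by (intro s_far_commute) auto
    then have "inv (s i) \<otimes> s k = s k \<otimes> inv (s i)" using 1 True by (intro commute_inv) auto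
    moreover have "s k \<otimes> rep n (Suc i) = rep n (Suc i) \<otimes> s k" using 1 True by auto
    ultimately show ?thesis using 1 True
      by (simp add: rep_step) (intro mult_commute; simp)
  next
    case False
    then have "i = n" using 1 by simp
    then show ?thesis using 1 by simp
  qed
qed

text \<open>The product \<open>rep n (Suc i) \<otimes> s i\<close> differs from
  \<open>rep n i\<close> by a square of \<open>s i\<close>; this lemma turns that square into a loop
  on the left.\<close>

lemma rep_square:
  assumes "1 \<le> i" "i < n" "n \<le> N"
  shows "rep n (Suc i) \<otimes> (s i \<otimes> s i) = loop n i \<otimes> rep n (Suc i)"
  using assms
proof (induction n i rule: loop.induct)
  case (1 n i)
  show ?case
  proof (cases "Suc i < n")
    case False
    then have "n = Suc i" using 1 by auto
    then show ?thesis using 1 by (simp add: loop_end)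
  next
    case True
    let ?s = "s i" and ?t = "s (Suc i)" and ?r = "rep n (Suc (Suc i))" and ?a = "loop n (Suc i)"
    have cl [simp]: "?s \<in> carrier B" "?t \<in> carrier B" "?r \<in> carrier B" "?a \<in> carrier B"
      using 1 True by auto
    have com: "?s \<otimes> ?r = ?r \<otimes> ?s"
      using 1 True by (intro s_rep_below) auto
    have IH: "?r \<otimes> (?t \<otimes> ?t) = ?a \<otimes> ?r" using 1 True by auto
    have "rep n (Suc i) \<otimes> (?s \<otimes> ?s) = ?r \<otimes> (inv ?t \<otimes> (?s \<otimes> ?s))"
      using True by (simp add: rep_step m_assoc)
    also have "\<dots> = (?r \<otimes> ?s) \<otimes> (?t \<otimes> ?t) \<otimes> inv ?s \<otimes> inv ?t"
      using 1 True s_braid[of i] by (subst braid_square_conj) (auto simp: m_assoc)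
    also have "\<dots> = ?s \<otimes> (?r \<otimes> (?t \<otimes> ?t)) \<otimes> inv ?s \<otimes> inv ?t"
      by (simp add: com[symmetric] m_assoc)
    also have "\<dots> = ?s \<otimes> ?a \<otimes> (?r \<otimes> inv ?s) \<otimes> inv ?t"
      by (simp add: IH m_assoc)
    also have "?r \<otimes> inv ?s = inv ?s \<otimes> ?r" using com by (simp add: commute_inv)
    also have "?s \<otimes> ?a \<otimes> (inv ?s \<otimes> ?r) \<otimes> inv ?t = loop n i \<otimes> rep n (Suc i)"
      using True by (simp add: rep_step loop_step m_assoc)
    finally show ?thesis .
  qed
qed

section \<open>The subgroup pushing the last strand around the others, and its conjugation by braids
  of the others\<close>

definition push :: "nat \<Rightarrow> 'a set" where
  "push n = generate B (loop n ` {1..<n})"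

lemma subgroup_sub: "n \<le> N \<Longrightarrow> subgroup (sub n) B"
  unfolding sub_def by (rule generate_is_subgroup) auto

lemma subgroup_push: "n \<le> N \<Longrightarrow> subgroup (push n) B"
  unfolding push_def by (rule generate_is_subgroup) auto

lemma s_in_sub: "k \<in> {1..<n} \<Longrightarrow> s k \<in> sub n"
  unfolding sub_def by (intro generate.incl) auto

lemma loop_in_push: "i \<in> {1..<n} \<Longrightarrow> loop n i \<in> push n"
  unfolding push_def by (intro generate.incl) auto

text \<open>Conjugation by \<open>s k\<close> fixes every loop except two neighbours a =
  \<open>loop n (Suc k)\<close> and b = \<open>loop n k\<close>. It sends a to b and b to the
  conjugate of a by the inverse of b; the inverse conjugation sends b to a and a to the conjugate of
  b by a.\<close>

lemma s_conj_loop: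
  assumes k: "1 \<le> k" "Suc k < n" and i: "i \<in> {1..<n}" and n: "n \<le> N"
  shows "s k \<otimes> loop n i \<otimes> inv (s k) \<in> push n" "inv (s k) \<otimes> loop n i \<otimes> s k \<in> push n"
proof -
  interpret push: subgroup "push n" B using n by (rule subgroup_push)
  have c [simp]: "s k \<in> carrier B" "loop n i \<in> carrier B" using assms by auto
  have "s k \<otimes> loop n i \<otimes> inv (s k) \<in> push n \<and> inv (s k) \<otimes> loop n i \<otimes> s k \<in> push n"
  proof (cases "i = k \<or> i = Suc k")
    case False
    then have com: "s k \<otimes> loop n i = loop n i \<otimes> s k"
      using assms by (cases "i < k") (auto intro: s_loop_above s_loop_below)
    have "s k \<otimes> loop n i \<otimes> inv (s k) = loop n i" unfolding com by (simp add: m_assoc)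
    moreover have "inv (s k) \<otimes> loop n i \<otimes> s k = loop n i"
      by (simp add: m_assoc com[symmetric])
    ultimately show ?thesis using i by (simp add: loop_in_push)
  next
    case True
    let ?s = "s k" and ?a = "loop n (Suc k)" and ?b = "loop n k"
    have ab: "?a \<in> push n" "?b \<in> push n" using k by (auto intro: loop_in_push)
    then have cab [simp]: "?a \<in> carrier B" "?b \<in> carrier B" by auto
    have b: "?b = ?s \<otimes> ?a \<otimes> inv ?s" using k by (simp add: loop_step)
    have "?s \<otimes> ?a \<otimes> ?s \<otimes> ?a = ?a \<otimes> ?s \<otimes> ?a \<otimes> ?s"
      using k n by (intro s_loop_type_B) auto
    then have "?s \<otimes> ?a \<otimes> ?s \<otimes> ?a \<otimes> inv ?s = ?a \<otimes> ?s \<otimes> ?a \<otimes> ?s \<otimes> inv ?s" by simp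
    \<comment> \<open>The length-four relation, read as commutation of \<open>s k\<close> with the
      product of the two loops.\<close>
    then have E: "?s \<otimes> (?a \<otimes> ?b) = ?a \<otimes> ?b \<otimes> ?s" unfolding b by (simp add: m_assoc)
    have 1: "?s \<otimes> ?b \<otimes> inv ?s = inv ?b \<otimes> ?a \<otimes> ?b"
    proof -
      have "?b \<otimes> ?s \<otimes> ?b = ?a \<otimes> ?b \<otimes> ?s" unfolding E[symmetric] by (simp add: b m_assoc)
      then have "inv ?b \<otimes> (?b \<otimes> ?s \<otimes> ?b) = inv ?b \<otimes> (?a \<otimes> ?b \<otimes> ?s)" by simp
      then have "?s \<otimes> ?b = inv ?b \<otimes> ?a \<otimes> ?b \<otimes> ?s" by (simp add: m_assoc)
      then show ?thesis by (simp add: m_assoc)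
    qed
    have 2: "inv ?s \<otimes> ?a \<otimes> ?s = ?a \<otimes> ?b \<otimes> inv ?a"
    proof -
      have "?s \<otimes> (?a \<otimes> ?b \<otimes> inv ?a) = ?a \<otimes> ?b \<otimes> ?s \<otimes> inv ?a" by (simp add: E[symmetric] m_assoc)
      also have "\<dots> = ?a \<otimes> ?s" by (simp add: b m_assoc)
      finally have "inv ?s \<otimes> (?s \<otimes> (?a \<otimes> ?b \<otimes> inv ?a)) = inv ?s \<otimes> (?a \<otimes> ?s)" by simp
      then show ?thesis by (simp add: m_assoc)
    qed
    have 3: "inv ?s \<otimes> ?b \<otimes> ?s = ?a" by (simp add: b m_assoc)
    show ?thesis using True ab 1 2 3 b[symmetric] by auto
  qed
  then show "s k \<otimes> loop n i \<otimes> inv (s k) \<in> push n" "inv (s k) \<otimes> loop n i \<otimes> s k \<in> push n" by auto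
qed

lemma conj_generate_subset:
  assumes x: "x \<in> carrier B" and X: "X \<subseteq> carrier B"
    and conj: "\<And>y. y \<in> X \<Longrightarrow> x \<otimes> y \<otimes> inv x \<in> generate B X" and g: "g \<in> generate B X"
  shows "x \<otimes> g \<otimes> inv x \<in> generate B X"
  using g
proof (induction rule: generate.induct)
  case one
  show ?case using x generate.one[of B X] by simp
next
  case (inv y)
  then have "inv (x \<otimes> y \<otimes> inv x) \<in> generate B X"
    using conj generate_m_inv_closed[OF X] by blast
  then show ?case using inv X x by (auto simp: inv_mult_group m_assoc subset_iff)
next
  case (eng g h)
  then have "g \<in> carrier B" "h \<in> carrier B" using generate_in_carrier[OF X] by auto
  then have "x \<otimes> (g \<otimes> h) \<otimes> inv x = (x \<otimes> g \<otimes> inv x) \<otimes> (x \<otimes> h \<otimes> inv x)"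
    using x by (simp add: m_assoc)
  then show ?case using eng generate.eng by metis
qed (rule conj)

text \<open>Thus \<open>sub (n - 1)\<close> normalizes \<open>push n\<close>, which allows a factor
  from \<open>push n\<close> to be moved to the left of one from \<open>sub (n - 1)\<close>.\<close>

lemma sub_conj_push:
  assumes v: "v \<in> sub (n - 1)" and f: "f \<in> push n" and n: "n \<le> N"
  shows "v \<otimes> f \<otimes> inv v \<in> push n"
  using v f unfolding sub_def
proof (induction arbitrary: f rule: generate.induct)
  case one
  then show ?case using subgroup.mem_carrier[OF subgroup_push[OF n]] by simp
next
  case (incl x)
  then obtain k where k: "x = s k" "1 \<le> k" "Suc k < n" by auto
  show ?case unfolding push_def
    by (rule conj_generate_subset) (use incl(2) k n s_conj_loop[of k n] in \<open>auto simp: push_def\<close>)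
next
  case (inv x)
  then obtain k where k: "x = s k" "1 \<le> k" "Suc k < n" by auto
  show ?case unfolding push_def
    by (rule conj_generate_subset) (use inv(2) k n s_conj_loop[of k n] in \<open>auto simp: push_def\<close>)
next
  case (eng g h)
  have "s ` {1..<n - 1} \<subseteq> carrier B" using n by auto
  then have "g \<in> carrier B" "h \<in> carrier B" "f \<in> carrier B"
    using eng generate_in_carrier subgroup.mem_carrier[OF subgroup_push[OF n]] by auto
  then have "g \<otimes> h \<otimes> f \<otimes> inv (g \<otimes> h) = g \<otimes> (h \<otimes> f \<otimes> inv h) \<otimes> inv g"
    by (simp add: inv_mult_group m_assoc)
  then show ?case using eng by simp
qed

text \<open>The index of \<open>rep n j\<close> behaves like the position of a strand: right
  multiplication by \<open>s k\<close> or its inverse exchanges \<open>k\<close> and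
  \<open>Suc k\<close>, possibly leaving a loop on the left. Every other index stays, and a
  generator of \<open>sub (n - 1)\<close> or its inverse comes out on the left.\<close>

lemma rep_mult_s:
  assumes j: "j \<in> {1..n}" and k: "k \<in> {1..<n}" and n: "n \<le> N" and x: "x \<in> {s k, inv (s k)}"
  shows "\<exists>f\<in>push n. \<exists>v\<in>sub (n - 1). \<exists>j'\<in>{1..n}. rep n j \<otimes> x = f \<otimes> v \<otimes> rep n j'"
proof -
  interpret push: subgroup "push n" B using n by (rule subgroup_push)
  interpret sub: subgroup "sub (n - 1)" B using n by (intro subgroup_sub) auto
  have sc [simp]: "s k \<in> carrier B" "rep n j \<in> carrier B" using assms by auto
  \<comment> \<open>When the representative stays the same, the case of the inverse generator
    follows from that of \<open>s k\<close>.\<close>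
  have via_sub: ?thesis if v: "v \<in> sub (n - 1)" and "rep n j \<otimes> s k = v \<otimes> rep n j" for v
  proof (cases "x = s k")
    case True
    then show ?thesis using that push.one_closed j by (metis l_one sub.mem_carrier)
  next
    case False
    have vc: "v \<in> carrier B" using v by auto
    have "inv v \<otimes> (rep n j \<otimes> s k) \<otimes> inv (s k) = inv v \<otimes> (v \<otimes> rep n j) \<otimes> inv (s k)"
      using that by simp
    then have "rep n j \<otimes> inv (s k) = inv v \<otimes> rep n j" using vc by (simp add: m_assoc)
    then show ?thesis using False x v vc push.one_closed j by (metis inv_closed insertE l_one singletonD sub.m_inv_closed)
  qed
  have via_push: ?thesis if "f \<in> push n" "j' \<in> {1..n}" "rep n j \<otimes> x = f \<otimes> rep n j'" for f j'
    using that sub.one_closed by (metis push.mem_carrier r_one)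
  consider "Suc k < j" | "j = Suc k" | "j = k" | "j < k" by linarith
  then show ?thesis
  proof cases
    case 1
    then have "rep n j \<otimes> s k = s k \<otimes> rep n j" using j k n by (intro s_rep_below[symmetric]) auto
    then show ?thesis using 1 j k by (intro via_sub[of "s k"] s_in_sub) auto
  next
    case 2
    have r: "rep n k = rep n j \<otimes> inv (s k)" using 2 k by (simp add: rep_step)
    show ?thesis
    proof (cases "x = s k")
      case True
      have "rep n j \<otimes> (s k \<otimes> s k) = loop n k \<otimes> rep n j"
        using k n 2 rep_square[of k n] by simp
      then have "rep n j \<otimes> (s k \<otimes> s k) \<otimes> inv (s k) = loop n k \<otimes> rep n j \<otimes> inv (s k)" by simp
      then have "rep n j \<otimes> x = loop n k \<otimes> rep n k" using True k n by (simp add: r m_assoc)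
      then show ?thesis using k by (intro via_push[of "loop n k" k] loop_in_push) auto
    next
      case False
      then show ?thesis using x r k n by (intro via_push[of \<one> k] push.one_closed) auto
    qed
  next
    case 3
    have r: "rep n j = rep n (Suc k) \<otimes> inv (s k)" and c: "rep n (Suc k) \<in> carrier B"
      using 3 k n by (auto simp: rep_step)
    have r': "rep n (Suc k) = rep n j \<otimes> s k" unfolding r using c by (simp add: m_assoc)
    show ?thesis
    proof (cases "x = s k")
      case True
      then show ?thesis using r' k n c by (intro via_push[of \<one> "Suc k"] push.one_closed) auto
    next
      case False
      have "rep n (Suc k) \<otimes> (s k \<otimes> s k) = loop n k \<otimes> rep n (Suc k)"
        using k n rep_square[of k n] by simp
      then have "inv (loop n k) \<otimes> (rep n (Suc k) \<otimes> (s k \<otimes> s k)) = rep n (Suc k)"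
        using k n c by simp
      then have "rep n j \<otimes> inv (s k) =
          inv (loop n k) \<otimes> (rep n (Suc k) \<otimes> (s k \<otimes> s k)) \<otimes> inv (s k) \<otimes> inv (s k)"
        by (simp add: r)
      also have "\<dots> = inv (loop n k) \<otimes> rep n (Suc k)"
        using k n c by (simp add: m_assoc)
      finally show ?thesis using False x k
        by (intro via_push[of "inv (loop n k)" "Suc k"] push.m_inv_closed loop_in_push) auto
    qed
  next
    case 4
    \<comment> \<open>For \<open>j < k\<close>, conjugation by \<open>rep n j\<close> lowers the
      index of \<open>s k\<close> by one. The shift happens where \<open>k = Suc j\<close>; factors
      of smaller index commute with \<open>s k\<close>.\<close>
    have "rep n j \<otimes> s k = s (k - 1) \<otimes> rep n j"
      using 4 j(1) k n sc
    proof (induction n j rule: rep.induct)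
      case (1 n j)
      have "k - 1 \<in> {1..<N}" using 1 by auto
      then have k1: "s (k - 1) \<in> carrier B" by (rule s_closed)
      have jn: "j < n" and c [simp]: "rep n (Suc j) \<in> carrier B" "rep n (Suc k) \<in> carrier B"
          "s j \<in> carrier B" "s k \<in> carrier B" "s (k - Suc 0) \<in> carrier B"
        using 1 k1 by auto
      show ?case
      proof (cases "k = Suc j")
        case False
        then have IH: "rep n (Suc j) \<otimes> s k = s (k - 1) \<otimes> rep n (Suc j)" using 1 jn by auto
        have "s j \<otimes> s k = s k \<otimes> s j" using 1 False by (intro s_far_commute) auto
        then have "inv (s j) \<otimes> s k = s k \<otimes> inv (s j)" by (simp add: commute_inv)
        then have "rep n j \<otimes> s k = (rep n (Suc j) \<otimes> s k) \<otimes> inv (s j)"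
          using jn by (simp add: rep_step m_assoc)
        then show ?thesis unfolding IH using jn by (simp add: rep_step m_assoc)
      next
        case True
        have com: "s j \<otimes> rep n (Suc k) = rep n (Suc k) \<otimes> s j"
          using 1 True by (intro s_rep_below) auto
        have "inv (s k) \<otimes> s j \<otimes> s k = s j \<otimes> s k \<otimes> inv (s j)"
          using 1 True s_braid[of j] by (intro braid_inv_conj) auto
        then have "inv (inv (s k) \<otimes> s j \<otimes> s k) = inv (s j \<otimes> s k \<otimes> inv (s j))" by simp
        then have e: "inv (s k) \<otimes> (inv (s j) \<otimes> s k) = s j \<otimes> (inv (s k) \<otimes> inv (s j))"
          by (simp add: inv_mult_group m_assoc)
        have "rep n j \<otimes> s k = rep n (Suc k) \<otimes> (inv (s k) \<otimes> (inv (s j) \<otimes> s k))"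
          using jn True 1 by (simp add: rep_step m_assoc)
        also have "\<dots> = (rep n (Suc k) \<otimes> s j) \<otimes> (inv (s k) \<otimes> inv (s j))"
          unfolding e by (simp add: m_assoc)
        also have "\<dots> = s j \<otimes> (rep n (Suc k) \<otimes> (inv (s k) \<otimes> inv (s j)))"
          unfolding com[symmetric] by (simp add: m_assoc)
        also have "\<dots> = s (k - 1) \<otimes> rep n j"
          using jn True 1 by (simp add: rep_step m_assoc)
        finally show ?thesis .
      qed
    qed
    then show ?thesis using 4 j k by (intro via_sub[of "s (k - 1)"] s_in_sub) auto
  qed
qed

text \<open>The set \<open>M\<close> of these products contains the identity and is stable under
  right multiplication by the generators and their inverses, hence contains
  \<open>sub n\<close>.\<close>

lemma sub_decomposition:
  assumes g: "g \<in> sub n" and n: "1 \<le> n" "n \<le> N"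
  shows "\<exists>f\<in>push n. \<exists>v\<in>sub (n - 1). \<exists>j\<in>{1..n}. g = f \<otimes> v \<otimes> rep n j"
proof -
  interpret push: subgroup "push n" B using n by (intro subgroup_push)
  interpret sub: subgroup "sub (n - 1)" B using n by (intro subgroup_sub) auto
  define M where "M = {f \<otimes> v \<otimes> rep n j | f v j. f \<in> push n \<and> v \<in> sub (n - 1) \<and> j \<in> {1..n}}"
  have step: "m \<otimes> x \<in> M" if m: "m \<in> M" and x: "x \<in> {s k, inv (s k)}" and k: "k \<in> {1..<n}" for m x k
  proof -
    obtain f v j where m': "m = f \<otimes> v \<otimes> rep n j" and fv: "f \<in> push n" "v \<in> sub (n - 1)" "j \<in> {1..n}"
      using m by (auto simp: M_def)
    obtain f' v' j' where r: "rep n j \<otimes> x = f' \<otimes> v' \<otimes> rep n j'"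
      and fv': "f' \<in> push n" "v' \<in> sub (n - 1)" "j' \<in> {1..n}"
      using rep_mult_s[OF fv(3) k n(2) x] by auto
    have [simp]: "f \<in> carrier B" "v \<in> carrier B" "f' \<in> carrier B" "v' \<in> carrier B"
        "rep n j \<in> carrier B" "rep n j' \<in> carrier B" "x \<in> carrier B"
      using fv fv' n k x by auto
    have "m \<otimes> x = f \<otimes> v \<otimes> (rep n j \<otimes> x)" by (simp add: m' m_assoc)
    \<comment> \<open>The factor \<open>f'\<close> crosses \<open>v\<close> at the price of a
      conjugation, which stays in \<open>push n\<close>.\<close>
    also have "\<dots> = (f \<otimes> (v \<otimes> f' \<otimes> inv v)) \<otimes> (v \<otimes> v') \<otimes> rep n j'"
      unfolding r by (simp add: m_assoc)
    finally show ?thesis using fv fv' n sub_conj_push[of v n f'] unfolding M_def by blast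
  qed
  have "\<forall>m\<in>M. m \<otimes> g \<in> M"
    using g unfolding sub_def
  proof (induction rule: generate.induct)
    case one
    have "m \<in> carrier B" if "m \<in> M" for m using that n by (auto simp: M_def)
    then show ?case by simp
  next
    case (eng g h)
    have "s ` {1..<n} \<subseteq> carrier B" using n by auto
    then have "g \<in> carrier B" "h \<in> carrier B"
      using eng generate_in_carrier by blast+
    moreover have "m \<in> carrier B" if "m \<in> M" for m using that n by (auto simp: M_def)
    ultimately show ?case using eng by (metis m_assoc)
  qed (use step in fastforce)+
  moreover have "\<one> \<in> M"
    using n push.one_closed sub.one_closed unfolding M_def
    by (intro CollectI exI[of _ \<one>] exI[of _ n]) auto
  moreover have "g \<in> carrier B" using g n subgroup.mem_carrier[OF subgroup_sub] by auto
  ultimately have "g \<in> M" by (metis l_one)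
  then show ?thesis unfolding M_def by blast
qed

end

section \<open>Reduced words in free products\<close>

definition reduced_words :: "('h, 'b) monoid_scheme \<Rightarrow> 'i set \<Rightarrow> ('i \<times> 'h) list set" where
  "reduced_words H I = {l. distinct_adj (map fst l) \<and> set l \<subseteq> I \<times> (carrier H - {\<one>\<^bsub>H\<^esub>})}"

lemma reduced_words_Nil [simp]: "[] \<in> reduced_words H I"
  by (simp add: reduced_words_def)

lemma reduced_words_Cons:
  "p # l \<in> reduced_words H I \<longleftrightarrow>
    fst p \<in> I \<and> snd p \<in> carrier H - {\<one>\<^bsub>H\<^esub>} \<and> l \<in> reduced_words H I \<and> (l \<noteq> [] \<longrightarrow> fst p \<noteq> fst (hd l))"
  by (cases l; cases p) (auto simp: reduced_words_def)

lemma reduced_words_append: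
  "k @ l \<in> reduced_words H I \<longleftrightarrow> k \<in> reduced_words H I \<and> l \<in> reduced_words H I \<and>
    (k \<noteq> [] \<longrightarrow> l \<noteq> [] \<longrightarrow> fst (last k) \<noteq> fst (hd l))"
  by (auto simp: reduced_words_def distinct_adj_append_iff last_map hd_map)

lemma reduced_words_mono: "l \<in> reduced_words H J \<Longrightarrow> J \<subseteq> I \<Longrightarrow> l \<in> reduced_words H I"
  by (auto simp: reduced_words_def)

lemma reduced_words_D: "l \<in> reduced_words H I \<Longrightarrow> set l \<subseteq> I \<times> carrier H"
  by (auto simp: reduced_words_def)

lemma reduced_words_ends:
  "l \<in> reduced_words H I \<Longrightarrow> l \<noteq> [] \<Longrightarrow> fst (hd l) \<in> I \<and> fst (last l) \<in> I"
  using hd_in_set[of l] last_in_set[of l] by (fastforce dest: reduced_words_D)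

definition inv_word :: "('h, 'b) monoid_scheme \<Rightarrow> ('i \<times> 'h) list \<Rightarrow> ('i \<times> 'h) list" where
  "inv_word H l = rev (map (\<lambda>(i, y). (i, inv\<^bsub>H\<^esub> y)) l)"

lemma inv_word_Nil_iff [simp]: "inv_word H l = [] \<longleftrightarrow> l = []"
  by (simp add: inv_word_def)

lemma fst_hd_inv_word: "l \<noteq> [] \<Longrightarrow> fst (hd (inv_word H l)) = fst (last l)"
  by (simp add: inv_word_def hd_rev last_map split: prod.split)

lemma (in group) inv_word_reduced:
  "l \<in> reduced_words G I \<Longrightarrow> inv_word G l \<in> reduced_words G I"
  by (force simp: reduced_words_def inv_word_def rev_map[symmetric] comp_def case_prod_unfold)

section \<open>Van der Waerden's action of letters on reduced words\<close>

fun rcons :: "('h, 'b) monoid_scheme \<Rightarrow> 'i \<times> 'h \<Rightarrow> ('i \<times> 'h) list \<Rightarrow> ('i \<times> 'h) list" where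
  "rcons H (i, x) [] = (if x = \<one>\<^bsub>H\<^esub> then [] else [(i, x)])"
| "rcons H (i, x) ((j, y) # l) =
    (if x = \<one>\<^bsub>H\<^esub> then (j, y) # l
     else if i = j then (if x \<otimes>\<^bsub>H\<^esub> y = \<one>\<^bsub>H\<^esub> then l else (i, x \<otimes>\<^bsub>H\<^esub> y) # l)
     else (i, x) # (j, y) # l)"

context group begin

lemma rcons_reduced:
  assumes "l \<in> reduced_words G I" "i \<in> I" "x \<in> carrier G"
  shows "rcons G (i, x) l \<in> reduced_words G I"
  using assms
  by (cases "(G, (i, x), l)" rule: rcons.cases) (auto simp: reduced_words_Cons split: if_splits)

lemma rcons_one [simp]: "rcons G (i, \<one>) l = l"
  by (cases "(G, (i, \<one>), l)" rule: rcons.cases) auto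

text \<open>This makes the action compatible with the multiplication tables of the factors, which
  are the relations of the free product.\<close>

lemma rcons_mult:
  assumes "l \<in> reduced_words G I" "i \<in> I" "x \<in> carrier G" "y \<in> carrier G"
  shows "rcons G (i, x) (rcons G (i, y) l) = rcons G (i, x \<otimes> y) l"
proof (cases l)
  case Nil
  then show ?thesis using assms by auto
next
  case (Cons p k)
  obtain j z where p: "p = (j, z)" by (cases p)
  have z: "z \<in> carrier G" "z \<noteq> \<one>" and k: "k = [] \<or> fst (hd k) \<noteq> j"
    using assms(1) Cons p by (auto simp: reduced_words_Cons)
  \<comment> \<open>The tail of a reduced word does not begin with the index of the head, so a
    letter of that index is put in front without merging.\<close>
  have k': "rcons G (j, w) k = (if w = \<one> then k else (j, w) # k)" for w
    using k by (cases k) auto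
  have *: "x \<otimes> (y \<otimes> z) = x" if "y \<otimes> z = \<one>" using that assms by simp
  have **: "x \<otimes> (y \<otimes> z) = z" if "x \<otimes> y = \<one>" using that assms z by (simp flip: m_assoc)
  show ?thesis
  proof (cases "i = j")
    case True
    then show ?thesis
      using assms z * **
      by (cases "y = \<one>"; cases "y \<otimes> z = \<one>"; cases "x = \<one>"; cases "x \<otimes> y = \<one>")
        (auto simp: Cons p k' m_assoc)
  next
    case False
    then show ?thesis using assms by (auto simp: Cons p)
  qed
qed

lemma foldr_rcons_reduced:
  assumes "w \<in> lists (I \<times> carrier G)" "l \<in> reduced_words G I"
  shows "foldr (rcons G) w l \<in> reduced_words G I"
  using assms by (induction w) (auto intro: rcons_reduced)

lemma foldr_rcons_id:
  "l \<in> reduced_words G I \<Longrightarrow> foldr (rcons G) l [] = l"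
proof (induction l)
  case (Cons p l)
  then show ?case by (cases p; cases l) (auto simp: reduced_words_Cons)
qed simp

lemma foldr_rcons_cong:
  assumes "(u, v) \<in> word_cong (SIGMA i:I. carrier G) (free_product_relations I (\<lambda>_. G))"
    and "l \<in> reduced_words G I"
  shows "foldr (rcons G) u l = foldr (rcons G) v l"
  using assms
proof (induction arbitrary: l rule: word_cong.induct)
  case (rel u v)
  then show ?case
    by (auto simp: free_product_relations_def rcons_mult)
next
  case (append u u' v v')
  have "v' \<in> lists (I \<times> carrier G)" using word_cong_lists[OF append(2)] by auto
  then show ?case using append foldr_rcons_reduced[of v' I l] by simp
qed simp_all

text \<open>Congruent words act in the same way on reduced words. Applied to the empty word, a
  reduced word \<open>l\<close> returns itself, so it is congruent to the empty word only when it is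
  empty.\<close>

lemma reduced_word_nontrivial:
  assumes l: "l \<in> reduced_words G I" "l \<noteq> []"
  shows "word_class (SIGMA i:I. carrier G) (free_product_relations I (\<lambda>_. G)) l \<noteq>
    word_class (SIGMA i:I. carrier G) (free_product_relations I (\<lambda>_. G)) []"
proof
  let ?A = "SIGMA i:I. carrier G" and ?R = "free_product_relations I (\<lambda>_. G)"
  assume eq: "word_class ?A ?R l = word_class ?A ?R []"
  have "l \<in> lists ?A" using reduced_words_D[OF l(1)] by auto
  then have "l \<in> word_class ?A ?R []" using word_class_self[of l ?A ?R] eq by simp
  then have "([], l) \<in> word_cong ?A ?R" by (simp add: word_class_def)
  then have "foldr (rcons G) [] [] = foldr (rcons G) l []" by (rule foldr_rcons_cong) simp
  then show False using foldr_rcons_id[OF l(1)] l(2) by simp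
qed

end

text \<open>Freeness is expressed by the nontriviality of reduced words and generation is not
  included. In this form it passes to subgroups generated by copies of a subgroup of
  \<open>H\<close>.\<close>

locale internal_free_product = H: group H + group G
  for H :: "('h, 'b) monoid_scheme" (structure) and G (structure) +
  fixes I :: "'i set" and \<phi> :: "'i \<Rightarrow> 'h \<Rightarrow> 'a"
  assumes \<phi>_hom: "i \<in> I \<Longrightarrow> \<phi> i \<in> hom H G"
    and free: "l \<in> reduced_words H I \<Longrightarrow> l \<noteq> [] \<Longrightarrow> word_eval G (\<lambda>(i, y). \<phi> i y) l \<noteq> \<one>\<^bsub>G\<^esub>"
begin

abbreviation mulG (infixl "\<cdot>" 70) where "x \<cdot> y \<equiv> x \<otimes>\<^bsub>G\<^esub> y"
abbreviation ginv where "ginv x \<equiv> inv\<^bsub>G\<^esub> x"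

abbreviation ev :: "('i \<times> 'h) list \<Rightarrow> 'a" where
  "ev \<equiv> word_eval G (\<lambda>(i, y). \<phi> i y)"

lemma \<phi>_closed [simp]: "i \<in> I \<Longrightarrow> y \<in> carrier H \<Longrightarrow> \<phi> i y \<in> carrier G"
  using \<phi>_hom by (auto simp: hom_def)

lemma \<phi>_mult: "i \<in> I \<Longrightarrow> x \<in> carrier H \<Longrightarrow> y \<in> carrier H \<Longrightarrow> \<phi> i (x \<otimes>\<^bsub>H\<^esub> y) = \<phi> i x \<cdot> \<phi> i y"
  using \<phi>_hom by (auto simp: hom_def)

lemma \<phi>_one [simp]: "i \<in> I \<Longrightarrow> \<phi> i \<one>\<^bsub>H\<^esub> = \<one>\<^bsub>G\<^esub>"
  using hom_one[OF \<phi>_hom H.is_group is_group] .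

lemma \<phi>_inv: "i \<in> I \<Longrightarrow> y \<in> carrier H \<Longrightarrow> \<phi> i (inv\<^bsub>H\<^esub> y) = ginv (\<phi> i y)"
  using group_hom.hom_inv[of H G "\<phi> i" y] \<phi>_hom by (simp add: group_hom_def group_hom_axioms_def)

lemma ev_closed [simp]: "set l \<subseteq> I \<times> carrier H \<Longrightarrow> ev l \<in> carrier G"
  by (induction l) auto

lemma ev_append [simp]:
  "set k \<subseteq> I \<times> carrier H \<Longrightarrow> set l \<subseteq> I \<times> carrier H \<Longrightarrow> ev (k @ l) = ev k \<cdot> ev l"
  by (induction k) (auto simp: m_assoc)

lemma inv_word_letters: "set l \<subseteq> J \<times> carrier H \<Longrightarrow> set (inv_word H l) \<subseteq> J \<times> carrier H"
  by (fastforce simp: inv_word_def)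

lemma ev_inv_word: "set l \<subseteq> I \<times> carrier H \<Longrightarrow> ev (inv_word H l) = ginv (ev l)"
proof (induction l)
  case (Cons p l)
  have "inv_word H (p # l) = inv_word H l @ [(fst p, inv\<^bsub>H\<^esub> (snd p))]"
    by (simp add: inv_word_def case_prod_unfold)
  then show ?case
    using Cons inv_word_letters[of l I] by (auto simp: \<phi>_inv inv_mult_group)
qed (simp add: inv_word_def)

text \<open>Reduction introduces no new index, so the letters stay in \<open>J\<close>. This keeps
  the blocks inserted in \<open>partial_conj_reduced\<close> apart from the letters outside
  \<open>J\<close>.\<close>

lemma exists_reduced:
  assumes "set l \<subseteq> J \<times> carrier H" "J \<subseteq> I"
  shows "\<exists>l'\<in>reduced_words H J. ev l' = ev l"
  using assms(1)
proof (induction l)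
  case Nil
  then show ?case by (intro bexI[of _ "[]"]) auto
next
  case (Cons p l)
  obtain i x where p: "p = (i, x)" "i \<in> J" "x \<in> carrier H" using Cons by (cases p) auto
  have iI: "i \<in> I" using p assms by auto
  obtain l' where l': "l' \<in> reduced_words H J" "ev l' = ev l" using Cons by auto
  consider "x = \<one>\<^bsub>H\<^esub>" | "x \<noteq> \<one>\<^bsub>H\<^esub>" "l' = [] \<or> fst (hd l') \<noteq> i"
    | y k where "l' = (i, y) # k" by (cases l') fastforce+
  then show ?case
  proof cases
    case 1
    have "ev l \<in> carrier G" using Cons.prems assms(2) by (intro ev_closed) auto
    then show ?thesis using 1 l' p iI by (intro bexI[of _ l']) auto
  next
    case 2
    then show ?thesis using l' p iI by (intro bexI[of _ "(i, x) # l'"]) (auto simp: reduced_words_Cons)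
  next
    case 3
    have y: "y \<in> carrier H" and k: "k \<in> reduced_words H J" "k \<noteq> [] \<Longrightarrow> fst (hd k) \<noteq> i"
      using l' 3 by (auto simp: reduced_words_Cons)
    have kc: "ev k \<in> carrier G"
      using reduced_words_D[OF reduced_words_mono[OF k(1) assms(2)]] by simp
    have e: "\<phi> i (x \<otimes>\<^bsub>H\<^esub> y) \<cdot> ev k = ev (p # l)"
      using 3 l' p iI y kc by (auto simp: \<phi>_mult m_assoc)
    show ?thesis
    proof (cases "x \<otimes>\<^bsub>H\<^esub> y = \<one>\<^bsub>H\<^esub>")
      case True
      then show ?thesis using e k kc iI by (intro bexI[of _ k]) auto
    next
      case False
      then show ?thesis using e k y p
        by (intro bexI[of _ "(i, x \<otimes>\<^bsub>H\<^esub> y) # k"]) (auto simp: reduced_words_Cons)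
    qed
  qed
qed

lemma not_commute:
  assumes l: "l \<in> reduced_words H I" "l \<noteq> []" "fst (hd l) \<noteq> n" and n: "n \<in> I"
    and h: "h \<in> carrier H" "h \<noteq> \<one>\<^bsub>H\<^esub>" and cent: "\<And>y. y \<in> carrier H \<Longrightarrow> h \<otimes>\<^bsub>H\<^esub> y = y \<otimes>\<^bsub>H\<^esub> h"
  shows "\<phi> n h \<cdot> ev l \<noteq> ev l \<cdot> \<phi> n h"
proof -
  have *: "\<phi> n h \<cdot> ev l \<noteq> ev l \<cdot> \<phi> n h"
    if l: "l \<in> reduced_words H I" "l \<noteq> []" "fst (hd l) \<noteq> n" and last: "fst (last l) \<noteq> n" for l
  proof
    assume eq: "\<phi> n h \<cdot> ev l = ev l \<cdot> \<phi> n h"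
    let ?w = "[(n, h)] @ l @ [(n, inv\<^bsub>H\<^esub> h)] @ inv_word H l"
    have "?w \<in> reduced_words H I"
      using l last n h H.inv_word_reduced[OF l(1)] fst_hd_inv_word[OF l(2), of H]
      by (auto simp: reduced_words_Cons reduced_words_append H.inv_eq_1_iff)
    moreover have "ev ?w = \<one>\<^bsub>G\<^esub>"
    proof -
      have c: "set l \<subseteq> I \<times> carrier H" using l(1) by (rule reduced_words_D)
      then have c': "set (inv_word H l) \<subseteq> I \<times> carrier H" by (rule inv_word_letters)
      have "ev ?w = (\<phi> n h \<cdot> ev l) \<cdot> ginv (\<phi> n h) \<cdot> ginv (ev l)"
        using c c' n h by (simp add: ev_inv_word \<phi>_inv m_assoc)
      also have "\<dots> = \<one>\<^bsub>G\<^esub>" unfolding eq using c n h by (simp add: m_assoc)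
      finally show ?thesis .
    qed
    ultimately show False using free[of ?w] by simp
  qed
  show ?thesis
  proof (cases "fst (last l) = n")
    case False
    then show ?thesis using * l by blast
  next
    case True
    obtain z where z: "l = butlast l @ [(n, z)]"
      using True l(2) by (metis append_butlast_last_id prod.collapse)
    define k where "k = butlast l"
    have lk: "l = k @ [(n, z)]" using z k_def by simp
    have k: "k \<noteq> []" using lk l by auto
    have kr: "k \<in> reduced_words H I" "z \<in> carrier H" "fst (last k) \<noteq> n" "fst (hd k) \<noteq> n"
      using l lk k by (auto simp: reduced_words_append reduced_words_Cons)
    have kc: "set k \<subseteq> I \<times> carrier H" using kr(1) by (rule reduced_words_D)
    show ?thesis
    proof
      assume "\<phi> n h \<cdot> ev l = ev l \<cdot> \<phi> n h"
      then have "\<phi> n h \<cdot> ev k \<cdot> \<phi> n z = ev k \<cdot> (\<phi> n z \<cdot> \<phi> n h)"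
        using kc n h kr by (simp add: lk m_assoc)
      also have "\<phi> n z \<cdot> \<phi> n h = \<phi> n h \<cdot> \<phi> n z"
        using n h kr cent by (simp flip: \<phi>_mult)
      finally have "\<phi> n h \<cdot> ev k \<cdot> \<phi> n z = ev k \<cdot> \<phi> n h \<cdot> \<phi> n z"
        using kc n h kr by (simp add: m_assoc)
      then have "\<phi> n h \<cdot> ev k = ev k \<cdot> \<phi> n h"
        using kc n h kr by simp
      then show False using *[OF kr(1) k kr(4) kr(3)] by blast
    qed
  qed
qed

text \<open>
  The partial conjugation \<open>\<Theta>\<close> inserts only letters with index in \<open>J\<close> between the letters with index
  outside \<open>J\<close>, so these never cancel; the insertion in front of the first one is kept apart.
\<close>

lemma partial_conj_reduced:
  assumes i: "J \<subseteq> I" and \<Theta>: "\<Theta> \<in> hom G G"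
    and fix_J: "\<And>j y. j \<in> J \<Longrightarrow> y \<in> carrier H \<Longrightarrow> \<Theta> (\<phi> j y) = \<phi> j y"
    and D: "\<And>j. j \<in> I - J \<Longrightarrow> set (D j) \<subseteq> J \<times> carrier H"
    and conj: "\<And>j y. j \<in> I - J \<Longrightarrow> y \<in> carrier H \<Longrightarrow>
      \<Theta> (\<phi> j y) = ev (D j) \<cdot> \<phi> j y \<cdot> ginv (ev (D j))"
    and z: "set z \<subseteq> J \<times> carrier H"
    and l: "l \<in> reduced_words H I" "l \<noteq> []" "fst (hd l) = j" "j \<in> I - J"
  shows "\<exists>r\<in>reduced_words H I. r \<noteq> [] \<and> fst (hd r) = j \<and> \<Theta> (ev l) \<cdot> ev z = ev (D j) \<cdot> ev r"
  using l
proof (induction "length l" arbitrary: l j rule: less_induct)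
  case less
  have lift: "set k \<subseteq> I \<times> carrier H" if "set k \<subseteq> J \<times> carrier H" for k
    using that i by auto
  have \<Theta>c: "\<Theta> x \<in> carrier G" if "x \<in> carrier G" for x using \<Theta> that by (auto simp: hom_def)
  have fixed: "\<Theta> (ev k) = ev k" if "set k \<subseteq> J \<times> carrier H" for k
    using that
  proof (induction k)
    case Nil
    then show ?case using hom_one[OF \<Theta> is_group is_group] by simp
  next
    case (Cons p k)
    then show ?case using i lift by (cases p) (auto simp: hom_mult[OF \<Theta>] fix_J)
  qed
  obtain y l1 where l: "l = (j, y) # l1" using less.prems by (cases l) auto
  have y: "y \<in> carrier H" "y \<noteq> \<one>\<^bsub>H\<^esub>" using less.prems l by (auto simp: reduced_words_Cons)
  have l1: "l1 \<in> reduced_words H I" using less.prems l by (auto simp: reduced_words_Cons)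
  \<comment> \<open>The word is cut into its first letter, the longest block \<open>e\<close> of
    letters with index in \<open>J\<close>, and a rest \<open>l2\<close> that is empty or begins
    outside \<open>J\<close>.\<close>
  define e where "e = takeWhile (\<lambda>p. fst p \<in> J) l1"
  define l2 where "l2 = dropWhile (\<lambda>p. fst p \<in> J) l1"
  have l1e: "l1 = e @ l2" by (simp add: e_def l2_def)
  have er: "e \<in> reduced_words H I" "l2 \<in> reduced_words H I" using l1 by (auto simp: l1e reduced_words_append)
  have eJ: "set e \<subseteq> J \<times> carrier H"
    using reduced_words_D[OF er(1)] by (fastforce simp: e_def dest: set_takeWhileD)
  note lc [simp] = lift[OF eJ] lift[OF D[OF less.prems(4)]] lift[OF z]
  have jI [simp]: "j \<in> I" using less by auto
  have dl2: "l2 \<noteq> [] \<Longrightarrow> fst (hd l2) \<in> I - J"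
    using reduced_words_ends[OF er(2)] hd_dropWhile[of "\<lambda>p. fst p \<in> J" l1]
    unfolding l2_def[symmetric] by auto
  have l2c [simp]: "set l2 \<subseteq> I \<times> carrier H" using er(2) by (rule reduced_words_D)
  have split: "\<Theta> (ev l) = ev (D j) \<cdot> (\<phi> j y \<cdot> (ginv (ev (D j)) \<cdot> (ev e \<cdot> \<Theta> (ev l2))))"
    using y conj[OF less.prems(4) y(1)] \<Theta>c
    by (simp add: l l1e hom_mult[OF \<Theta>] fixed eJ m_assoc)
  show ?case
  proof (cases "l2 = []")
    case True
    \<comment> \<open>No further letter outside \<open>J\<close> occurs, so the factor
      \<open>z\<close> is absorbed into the last block.\<close>
    have "set (inv_word H (D j) @ e @ z) \<subseteq> J \<times> carrier H"
      using inv_word_letters[OF D[OF less.prems(4)]] eJ z by auto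
    from exists_reduced[OF this i] obtain r where r: "r \<in> reduced_words H J"
      and re: "ev r = ev (inv_word H (D j) @ e @ z)" by blast
    have re': "ev r = ginv (ev (D j)) \<cdot> (ev e \<cdot> ev z)"
      unfolding re using inv_word_letters[of "D j" I] by (simp add: ev_inv_word)
    have "(j, y) # r \<in> reduced_words H I"
      using y reduced_words_mono[OF r i] reduced_words_ends[OF r] less.prems
      by (auto simp: reduced_words_Cons)
    moreover have "\<Theta> (ev l) \<cdot> ev z = ev (D j) \<cdot> ev ((j, y) # r)"
      unfolding split using True y hom_one[OF \<Theta> is_group is_group] by (simp add: re' m_assoc)
    ultimately show ?thesis by (intro bexI[of _ "(j, y) # r"]) auto
  next
    case False
    define j2 where "j2 = fst (hd l2)"
    have j2: "j2 \<in> I - J" using dl2[OF False] by (simp add: j2_def)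
    have "\<exists>r\<in>reduced_words H I. r \<noteq> [] \<and> fst (hd r) = j2 \<and> \<Theta> (ev l2) \<cdot> ev z = ev (D j2) \<cdot> ev r"
      using er False j2 by (intro less.hyps) (auto simp: l l1e j2_def)
    then obtain r2 where r2: "r2 \<in> reduced_words H I" "r2 \<noteq> []" "fst (hd r2) = j2"
      and r2e: "\<Theta> (ev l2) \<cdot> ev z = ev (D j2) \<cdot> ev r2" by blast
    have r2c [simp]: "set r2 \<subseteq> I \<times> carrier H" using r2(1) by (rule reduced_words_D)
    have D2 [simp]: "set (D j2) \<subseteq> I \<times> carrier H" using lift[OF D[OF j2]] .
    \<comment> \<open>Everything between two consecutive letters outside \<open>J\<close> is
      collected here and reduced inside \<open>J\<close>.\<close>
    have "set (inv_word H (D j) @ e @ D j2) \<subseteq> J \<times> carrier H"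
      using inv_word_letters[OF D[OF less.prems(4)]] eJ D[OF j2] by auto
    from exists_reduced[OF this i] obtain r where r: "r \<in> reduced_words H J"
      and re: "ev r = ev (inv_word H (D j) @ e @ D j2)" by blast
    have re': "ev r = ginv (ev (D j)) \<cdot> (ev e \<cdot> ev (D j2))"
      unfolding re using inv_word_letters[of "D j" I] by (simp add: ev_inv_word)
    have rc [simp]: "set r \<subseteq> I \<times> carrier H"
      using reduced_words_D[OF reduced_words_mono[OF r i]] .
    \<comment> \<open>The block between the two letters may vanish, but only if their indices
      differ: for \<open>j = j2\<close> it is a conjugate of \<open>e\<close>, so \<open>e\<close>
      would be empty and \<open>l\<close> would have two adjacent letters of index
      \<open>j\<close>.\<close>
    have ne: "j \<noteq> j2" if "r = []"
    proof
      assume "j = j2"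
      then have "ginv (ev (D j)) \<cdot> (ev e \<cdot> ev (D j)) = \<one>\<^bsub>G\<^esub>" using re' that by simp
      then have "ev (D j) \<cdot> (ginv (ev (D j)) \<cdot> (ev e \<cdot> ev (D j))) = ev (D j)" by simp
      then have "ev e = \<one>\<^bsub>G\<^esub>" by simp
      then have "e = []" using free er by blast
      then show False
        using less.prems(1) False \<open>j = j2\<close> by (auto simp: l l1e reduced_words_Cons j2_def)
    qed
    have "(j, y) # r @ r2 \<in> reduced_words H I"
      using y reduced_words_mono[OF r i] r2 less.prems reduced_words_ends[OF r] ne j2
      by (cases "r = []") (auto simp: reduced_words_Cons reduced_words_append)
    moreover have "\<Theta> (ev l) \<cdot> ev z = ev (D j) \<cdot> ev ((j, y) # r @ r2)"
    proof -
      have "\<Theta> (ev l) \<cdot> ev z = ev (D j) \<cdot> (\<phi> j y \<cdot> (ginv (ev (D j)) \<cdot> (ev e \<cdot> (\<Theta> (ev l2) \<cdot> ev z))))"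
        unfolding split using y \<Theta>c by (simp add: m_assoc)
      then show ?thesis using y by (simp add: re' r2e m_assoc)
    qed
    ultimately show ?thesis by (intro bexI[of _ "(j, y) # r @ r2"]) auto
  qed
qed

end

section \<open>The action of pure braids\<close>

text \<open>The setting after the reduction to central \<open>h\<close>. Centrality turns the
  conjugate of \<phi>_k(y) by h_k, the image of \<phi>_{k+1}(y), into \<phi>_k(y) in
  \<open>act_s\<close>.\<close>

locale artin_action =
  internal_free_product H G "{1..N}" \<phi> + B: braid_generators B N s
  for H :: "('h, 'b) monoid_scheme" and G :: "('a, 'c) monoid_scheme" and N :: nat
    and \<phi> :: "nat \<Rightarrow> 'h \<Rightarrow> 'a" and B :: "('g, 'd) monoid_scheme" (structure) and s :: "nat \<Rightarrow> 'g" +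
  fixes h :: 'h and act :: "'g \<Rightarrow> 'a \<Rightarrow> 'a"
  assumes h: "h \<in> carrier H" "h \<noteq> \<one>\<^bsub>H\<^esub>"
    and h_central: "y \<in> carrier H \<Longrightarrow> h \<otimes>\<^bsub>H\<^esub> y = y \<otimes>\<^bsub>H\<^esub> h"
    and generated: "carrier G = generate G (\<Union>j\<in>{1..N}. \<phi> j ` carrier H)"
    and kill_copy: "n \<in> {1..N} \<Longrightarrow> \<exists>\<pi>\<in>hom G G. \<forall>j\<in>{1..N}. \<forall>y\<in>carrier H.
      \<pi> (\<phi> j y) = (if j = n then \<one>\<^bsub>G\<^esub> else \<phi> j y)"
    and act_hom: "g \<in> carrier B \<Longrightarrow> act g \<in> hom G G"
    and act_mult: "g \<in> carrier B \<Longrightarrow> g' \<in> carrier B \<Longrightarrow> x \<in> carrier G \<Longrightarrow>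
      act (g \<otimes> g') x = act g (act g' x)"
    and act_one: "x \<in> carrier G \<Longrightarrow> act \<one> x = x"
    and act_s: "k \<in> {1..<N} \<Longrightarrow> j \<in> {1..N} \<Longrightarrow> y \<in> carrier H \<Longrightarrow>
      act (s k) (\<phi> j y) =
        (if j = k then ginv (\<phi> k h) \<cdot> \<phi> (Suc k) y \<cdot> \<phi> k h else if j = Suc k then \<phi> k y else \<phi> j y)"
begin

lemma act_closed [simp]: "g \<in> carrier B \<Longrightarrow> x \<in> carrier G \<Longrightarrow> act g x \<in> carrier G"
  using act_hom by (auto simp: hom_def)

lemma act_mul [simp]:
  "g \<in> carrier B \<Longrightarrow> x \<in> carrier G \<Longrightarrow> y \<in> carrier G \<Longrightarrow> act g (x \<cdot> y) = act g x \<cdot> act g y"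
  using act_hom by (auto simp: hom_def)

lemma act_unit [simp]: "g \<in> carrier B \<Longrightarrow> act g \<one>\<^bsub>G\<^esub> = \<one>\<^bsub>G\<^esub>"
  using hom_one[OF act_hom is_group is_group] .

lemma act_ginv [simp]: "g \<in> carrier B \<Longrightarrow> x \<in> carrier G \<Longrightarrow> act g (ginv x) = ginv (act g x)"
  using group_hom.hom_inv[of G G "act g" x] act_hom is_group
  by (simp add: group_hom_def group_hom_axioms_def)

lemma act_inverse:
  "g \<in> carrier B \<Longrightarrow> x \<in> carrier G \<Longrightarrow> act (inv g) (act g x) = x"
  "g \<in> carrier B \<Longrightarrow> x \<in> carrier G \<Longrightarrow> act g (act (inv g) x) = x"
  by (simp_all add: act_mult[symmetric] act_one)

lemma act_inv_s:
  assumes k: "k \<in> {1..<N}" and j: "j \<in> {1..N}" and y: "y \<in> carrier H"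
  shows "act (inv (s k)) (\<phi> j y) =
    (if j = k then \<phi> (Suc k) y
     else if j = Suc k then \<phi> (Suc k) h \<cdot> \<phi> k y \<cdot> ginv (\<phi> (Suc k) h) else \<phi> j y)" (is "_ = ?x")
proof -
  have kk: "k \<in> {1..N}" "Suc k \<in> {1..N}" using k by auto
  have "act (s k) ?x = \<phi> j y"
    using k kk y h j by (simp add: act_s m_assoc)
  moreover have "?x \<in> carrier G" using kk y h j by simp
  ultimately show ?thesis using act_inverse(1)[of "s k" ?x] k by simp
qed

lemma hom_eqI:
  assumes "f \<in> hom G G" "g \<in> hom G G"
    and eq: "\<And>j y. j \<in> {1..N} \<Longrightarrow> y \<in> carrier H \<Longrightarrow> f (\<phi> j y) = g (\<phi> j y)" and x: "x \<in> carrier G"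
  shows "f x = g x"
proof -
  let ?X = "\<Union>j\<in>{1..N}. \<phi> j ` carrier H"
  interpret f: group_hom G G f using assms by unfold_locales
  interpret g: group_hom G G g using assms by unfold_locales
  have X: "?X \<subseteq> carrier G" by auto
  have "x \<in> generate G ?X" using x generated by simp
  then show ?thesis
  proof (induction rule: generate.induct)
    case (inv x)
    then have "x \<in> carrier G" "f x = g x" using X eq by auto
    then show ?case by simp
  next
    case (eng x y)
    then show ?case using generated by simp
  qed (use eq in auto)
qed

lemma \<phi>_h_commute:
  assumes "j \<in> {1..N}" "y \<in> carrier H"
  shows "\<phi> j h \<cdot> \<phi> j y = \<phi> j y \<cdot> \<phi> j h" "ginv (\<phi> j h) \<cdot> \<phi> j y = \<phi> j y \<cdot> ginv (\<phi> j h)"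
proof -
  show *: "\<phi> j h \<cdot> \<phi> j y = \<phi> j y \<cdot> \<phi> j h"
    using assms h h_central by (simp flip: \<phi>_mult)
  show "ginv (\<phi> j h) \<cdot> \<phi> j y = \<phi> j y \<cdot> ginv (\<phi> j h)"
    using assms h by (intro commute_inv *) auto
qed

lemma \<phi>_h_left_commute:
  assumes "j \<in> {1..N}" "y \<in> carrier H" "x \<in> carrier G"
  shows "\<phi> j h \<cdot> (\<phi> j y \<cdot> x) = \<phi> j y \<cdot> (\<phi> j h \<cdot> x)"
  using assms h \<phi>_h_commute(1)[OF assms(1,2)] by (simp flip: m_assoc)

section \<open>The action of loops and of their powers\<close>

definition cc :: "nat \<Rightarrow> nat \<Rightarrow> 'a" where
  "cc n i = \<phi> n h \<cdot> \<phi> i h"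

text \<open>For \<open>j < i\<close> or \<open>j > n\<close> the twist \<open>cc n i\<close> cancels
  the outer conjugation in \<open>act_loop\<close>, so these copies are fixed by the loop; this
  gives all copies a common formula.\<close>

definition twist :: "nat \<Rightarrow> nat \<Rightarrow> nat \<Rightarrow> 'a" where
  "twist n i j = (if j = i \<or> j = n then \<one>\<^bsub>G\<^esub> else if i < j \<and> j < n then cc i n else cc n i)"

lemma cc_closed [simp]: "n \<in> {1..N} \<Longrightarrow> i \<in> {1..N} \<Longrightarrow> cc n i \<in> carrier G"
  by (simp add: cc_def h)

lemma twist_closed [simp]: "n \<in> {1..N} \<Longrightarrow> i \<in> {1..N} \<Longrightarrow> twist n i j \<in> carrier G"
  by (simp add: twist_def)

text \<open>Conjugation by \<open>s i\<close> transports the formula from \<open>Suc i\<close> to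
  \<open>i\<close>, because \<open>act (s i)\<close> takes \<open>cc n (Suc i)\<close> to
  \<open>cc n i\<close> and \<open>cc (Suc i) n\<close> to \<open>cc i n\<close>.\<close>

lemma act_loop:
  assumes "i \<in> {1..<n}" "n \<le> N" "j \<in> {1..N}" "y \<in> carrier H"
  shows "act (B.loop n i) (\<phi> j y) =
    ginv (cc n i) \<cdot> (twist n i j \<cdot> \<phi> j y \<cdot> ginv (twist n i j)) \<cdot> cc n i"
  using assms
proof (induction n i arbitrary: j y rule: B.loop.induct)
  case (1 n i)
  have ii: "i \<in> {1..N}" "n \<in> {1..N}" "Suc i \<in> {1..N}" "i \<in> {1..<N}" using 1 by auto
  note [simp] = ii[simplified] h 1(4,5)[simplified]
  show ?case
  proof (cases "Suc i < n")
    case True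
    have "act (B.loop n i) (\<phi> j y) = act (s i) (act (B.loop n (Suc i)) (act (inv (s i)) (\<phi> j y)))"
      using True 1 by (simp add: B.loop_step act_mult)
    have IH: "act (B.loop n (Suc i)) (\<phi> l z) = ginv (cc n (Suc i)) \<cdot>
        (twist n (Suc i) l \<cdot> \<phi> l z \<cdot> ginv (twist n (Suc i) l)) \<cdot> cc n (Suc i)"
      if "l \<in> {1..N}" "z \<in> carrier H" for l z
      using 1 True that by auto
    have Lc: "B.loop n (Suc i) \<in> carrier B" using 1 True by simp
    have c: "act (s i) (cc n (Suc i)) = cc n i" "act (s i) (cc (Suc i) n) = cc i n"
      using True by (auto simp: cc_def act_s)
    consider "j = i" | "j = Suc i" | "j \<noteq> i" "j \<noteq> Suc i" by blast
    then show ?thesis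
    proof cases
      case 1
      then show ?thesis
        using True Lc 
        by (simp add: B.loop_step act_mult act_inv_s IH twist_def c act_s)
    next
      \<comment> \<open>Strand \<open>Suc i\<close> changes from the one being encircled to one
        lying between \<open>i\<close> and \<open>n\<close>, so its twist changes from the identity
        to \<open>cc i n\<close>.\<close>
      case 2
      then show ?thesis
        using True Lc
        by (simp add: B.loop_step act_mult act_inv_s IH twist_def c act_s inv_mult_group m_assoc)
          (simp add: cc_def m_assoc inv_mult_group)
    next
      case 3
      then show ?thesis
        using True Lc \<open>j \<in> {1..N}\<close>
        by (simp add: B.loop_step act_mult act_inv_s IH) (auto simp: twist_def c act_s)
    qed
  next
    case False
    then have n: "n = Suc i" using 1 by auto
    consider "j = i" | "j = Suc i" | "j \<noteq> i" "j \<noteq> Suc i" by blast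
    then show ?thesis
    proof cases
      case 1
      then show ?thesis
        using \<phi>_h_commute[of i y] by (simp add: \<phi>_h_left_commute n B.loop_end act_mult act_s twist_def cc_def inv_mult_group m_assoc)
    next
      case 2
      then show ?thesis
        using \<phi>_h_commute[of n y] by (simp add: n B.loop_end act_mult act_s twist_def cc_def inv_mult_group m_assoc)
    next
      case 3
      then show ?thesis
        using \<open>j \<in> {1..N}\<close>
        by (simp add: n B.loop_end act_mult act_s twist_def cc_def inv_mult_group m_assoc) auto
    qed
  qed
qed

lemma loop_B [simp]: "i \<in> {1..<n} \<Longrightarrow> n \<le> N \<Longrightarrow> B.loop n i \<in> carrier B"
  by (rule B.loop_closed)

text \<open>Both elements are products of h_i and h_n, which \<open>g\<close> conjugates by one and
  the same power of \<open>cc n i\<close>; that power commutes with \<open>cc n i\<close>.\<close>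

lemma act_cc_twist:
  fixes m :: nat
  assumes cl: "g \<in> carrier B" "i \<in> {1..N}" "n \<in> {1..N}"
    and conj: "\<And>k. k = i \<or> k = n \<Longrightarrow>
      act g (\<phi> k h) = ginv (cc n i [^]\<^bsub>G\<^esub> m) \<cdot> \<phi> k h \<cdot> cc n i [^]\<^bsub>G\<^esub> m"
  shows "act g (cc n i) = cc n i"
    and "act g (twist n i j) = ginv (cc n i [^]\<^bsub>G\<^esub> m) \<cdot> twist n i j \<cdot> cc n i [^]\<^bsub>G\<^esub> m"
proof -
  let ?c = "cc n i" and ?p = "cc n i [^]\<^bsub>G\<^esub> m"
  note [simp] = cl[simplified] h(1)
  have com: "?c \<cdot> ?p = ?p \<cdot> ?c" using nat_pow_Suc2[of ?c m] by simp
  have "act g ?c = ginv ?p \<cdot> (?c \<cdot> ?p)"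
    by (simp add: cc_def conj m_assoc)
  then show c: "act g ?c = ?c" by (simp add: com)
  have "act g (cc i n) = ginv ?p \<cdot> cc i n \<cdot> ?p"
    by (simp add: cc_def conj m_assoc)
  moreover have "?c = ginv ?p \<cdot> ?c \<cdot> ?p" using com by (simp add: m_assoc)
  ultimately show "act g (twist n i j) = ginv ?p \<cdot> twist n i j \<cdot> ?p"
    using c by (auto simp: twist_def)
qed

text \<open>In the induction step the new twist arrives conjugated by the earlier power of
  \<open>cc n i\<close>. This is what collects the powers of the twist inside and those of
  \<open>cc n i\<close> outside.\<close>

lemma act_loop_nat_pow:
  fixes m :: nat
  assumes "i \<in> {1..<n}" "n \<le> N" "j \<in> {1..N}" "y \<in> carrier H"
  shows "act (B.loop n i [^] m) (\<phi> j y) = ginv (cc n i [^]\<^bsub>G\<^esub> m) \<cdot>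
    (twist n i j [^]\<^bsub>G\<^esub> m \<cdot> \<phi> j y \<cdot> ginv (twist n i j [^]\<^bsub>G\<^esub> m)) \<cdot> cc n i [^]\<^bsub>G\<^esub> m"
  using assms(3,4)
proof (induction m arbitrary: j y)
  case 0
  then show ?case by (simp add: act_one)
next
  case (Suc m)
  let ?A = "B.loop n i" and ?c = "cc n i" and ?C = "twist n i j"
  have ii: "i \<in> {1..N}" "n \<in> {1..N}" using assms by auto
  note [simp] = ii[simplified] assms(1,2)[simplified] Suc.prems[simplified] h(1)
  let ?p = "?c [^]\<^bsub>G\<^esub> m" and ?P = "?C [^]\<^bsub>G\<^esub> m"
  have conj: "act (?A [^] m) (\<phi> k h) = ginv ?p \<cdot> \<phi> k h \<cdot> ?p" if "k = i \<or> k = n" for k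
  proof -
    have "k \<in> {1..N}" "twist n i k = \<one>\<^bsub>G\<^esub>" using that ii by (auto simp: twist_def)
    then show ?thesis using Suc.IH[of k h] by simp
  qed
  have c: "act (?A [^] m) ?c = ?c" and C: "act (?A [^] m) ?C = ginv ?p \<cdot> ?C \<cdot> ?p"
    using act_cc_twist[of "?A [^] m" i n m, OF _ ii conj] by simp_all
  have "act (?A [^] Suc m) (\<phi> j y) = act (?A [^] m) (act ?A (\<phi> j y))"
    by (simp add: act_mult)
  also have "\<dots> = ginv ?c \<cdot> ginv ?p \<cdot> (?C \<cdot> ?P \<cdot> \<phi> j y \<cdot> ginv ?P \<cdot> ginv ?C) \<cdot> (?p \<cdot> ?c)"
    by (simp add: act_loop c C Suc.IH m_assoc inv_mult_group)
  also have "?C \<cdot> ?P \<cdot> \<phi> j y \<cdot> ginv ?P \<cdot> ginv ?C = (?C \<cdot> ?P) \<cdot> \<phi> j y \<cdot> ginv (?C \<cdot> ?P)"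
    by (simp add: m_assoc inv_mult_group)
  also have "?C \<cdot> ?P = ?C [^]\<^bsub>G\<^esub> Suc m"
    using nat_pow_Suc2[of ?C m] by simp
  also have "ginv ?c \<cdot> ginv ?p = ginv (?c [^]\<^bsub>G\<^esub> Suc m)"
    by (simp add: inv_mult_group)
  also have "?p \<cdot> ?c = ?c [^]\<^bsub>G\<^esub> Suc m" by simp
  finally show ?case .
qed

lemma act_loop_pow:
  fixes k :: int
  assumes i: "i \<in> {1..<n}" and n: "n \<le> N" and "j \<in> {1..N}" "y \<in> carrier H"
  shows "act (B.loop n i [^] k) (\<phi> j y) = ginv (cc n i [^]\<^bsub>G\<^esub> k) \<cdot>
    (twist n i j [^]\<^bsub>G\<^esub> k \<cdot> \<phi> j y \<cdot> ginv (twist n i j [^]\<^bsub>G\<^esub> k)) \<cdot> cc n i [^]\<^bsub>G\<^esub> k"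
proof (cases k rule: int_cases2)
  case (nonneg m)
  then show ?thesis using act_loop_nat_pow[OF assms] by (simp add: int_pow_int)
next
  case (nonpos m)
  let ?A = "B.loop n i [^] m" and ?c = "cc n i" and ?C = "twist n i j"
  have ii: "i \<in> {1..N}" "n \<in> {1..N}" using assms by auto
  note [simp] = ii[simplified] assms[simplified] h(1)
  let ?p = "?c [^]\<^bsub>G\<^esub> m" and ?P = "?C [^]\<^bsub>G\<^esub> m"
  have conj: "act ?A (\<phi> k h) = ginv ?p \<cdot> \<phi> k h \<cdot> ?p" if "k = i \<or> k = n" for k
  proof -
    have "k \<in> {1..N}" "twist n i k = \<one>\<^bsub>G\<^esub>" using that ii by (auto simp: twist_def)
    then show ?thesis using act_loop_nat_pow[OF i n, of k h m] by simp
  qed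
  have c: "act ?A ?c = ?c" and C: "act ?A ?C = ginv ?p \<cdot> ?C \<cdot> ?p"
    using act_cc_twist[of ?A i n m, OF _ ii conj] by simp_all
  have pow: "act ?A (x [^]\<^bsub>G\<^esub> l) = act ?A x [^]\<^bsub>G\<^esub> l" if "x \<in> carrier G" for x and l :: nat
    using that by (induction l) auto
  have conj_pow: "(ginv ?p \<cdot> (x \<cdot> ?p)) [^]\<^bsub>G\<^esub> l = ginv ?p \<cdot> (x [^]\<^bsub>G\<^esub> l \<cdot> ?p)" if "x \<in> carrier G" for x and l :: nat
    using that by (induction l) (auto simp: m_assoc)
  \<comment> \<open>The claimed value for the exponent \<open>- m\<close>. It suffices that the
    \<open>m\<close>-th power of the loop maps it to \<open>\<phi> j y\<close>.\<close>
  let ?Y = "?p \<cdot> (ginv ?P \<cdot> \<phi> j y \<cdot> ?P) \<cdot> ginv ?p"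
  have "act ?A ?Y = \<phi> j y"
    by (simp add: pow c C conj_pow act_loop_nat_pow inv_mult_group m_assoc)
  moreover have "act (inv ?A) (act ?A ?Y) = ?Y" by (rule act_inverse) simp_all
  ultimately have "act (inv ?A) (\<phi> j y) = ?Y" by simp
  moreover have "x [^]\<^bsub>G\<^esub> k = ginv (x [^]\<^bsub>G\<^esub> m)" if "x \<in> carrier G" for x
    using that nonpos by (simp add: int_pow_neg_int)
  moreover have "B.loop n i [^] k = inv ?A"
    using nonpos by (simp add: B.int_pow_neg_int)
  ultimately show ?thesis by simp
qed

section \<open>Powers of \<open>cc n i\<close> as reduced words, and the ping-pong step\<close>

lemma exists_alternating_word:
  assumes "p \<in> {1..N}" "q \<in> {1..N}" "p \<noteq> q" and u: "u \<in> carrier H" "u \<noteq> \<one>\<^bsub>H\<^esub>"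
  shows "\<exists>l\<in>reduced_words H {1..N}. set l \<subseteq> {p, q} \<times> carrier H \<and> (m > 0 \<longrightarrow> l \<noteq> []) \<and>
    (l \<noteq> [] \<longrightarrow> fst (hd l) = p) \<and> ev l = (\<phi> p u \<cdot> \<phi> q u) [^]\<^bsub>G\<^esub> (m :: nat)"
proof (induction m)
  case 0
  then show ?case by (intro bexI[of _ "[]"]) auto
next
  case (Suc m)
  then obtain l where l: "l \<in> reduced_words H {1..N}" "set l \<subseteq> {p, q} \<times> carrier H"
    "l \<noteq> [] \<longrightarrow> fst (hd l) = p" "ev l = (\<phi> p u \<cdot> \<phi> q u) [^]\<^bsub>G\<^esub> m" by blast
  have "(\<phi> p u \<cdot> \<phi> q u) [^]\<^bsub>G\<^esub> Suc m = \<phi> p u \<cdot> (\<phi> q u \<cdot> ev l)"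
    using assms l(4) nat_pow_Suc2[of "\<phi> p u \<cdot> \<phi> q u" m] by (simp add: m_assoc)
  then show ?case using l assms
    by (intro bexI[of _ "(p, u) # (q, u) # l"]) (auto simp: reduced_words_Cons)
qed

text \<open>A possible leading letter of index \<open>n\<close> is split off as
  \<open>\<phi> n y\<close>, so that the remaining word begins with \<open>i\<close> for either
  order of the two factors.\<close>

lemma exists_twist_word:
  assumes i: "i \<in> {1..N}" and n: "n \<in> {1..N}" "i \<noteq> n" and u: "u \<in> carrier H" "u \<noteq> \<one>\<^bsub>H\<^esub>"
    and m: "m > 0" and pq: "p = i \<and> q = n \<or> p = n \<and> q = i"
  shows "\<exists>y\<in>carrier H. \<exists>l\<in>reduced_words H {1..N}. l \<noteq> [] \<and> fst (hd l) = i \<and> set l \<subseteq> {i, n} \<times> carrier H \<and>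
    (\<phi> p u \<cdot> \<phi> q u) [^]\<^bsub>G\<^esub> (m :: nat) = \<phi> n y \<cdot> ev l"
  using pq
proof
  assume pq: "p = i \<and> q = n"
  obtain l where "l \<in> reduced_words H {1..N}" "set l \<subseteq> {i, n} \<times> carrier H" "l \<noteq> []" "fst (hd l) = i"
    "ev l = (\<phi> i u \<cdot> \<phi> n u) [^]\<^bsub>G\<^esub> m"
    using exists_alternating_word[OF i n u, of m] m by blast
  then show ?thesis using pq n i u
    by (intro bexI[of _ "\<one>\<^bsub>H\<^esub>"] bexI[of _ l]) auto
next
  assume pq: "p = n \<and> q = i"
  obtain m' where m': "m = Suc m'" using m by (cases m) auto
  obtain l where l: "l \<in> reduced_words H {1..N}" "set l \<subseteq> {n, i} \<times> carrier H" "l \<noteq> [] \<longrightarrow> fst (hd l) = n"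
    "ev l = (\<phi> n u \<cdot> \<phi> i u) [^]\<^bsub>G\<^esub> m'"
    using exists_alternating_word[OF n(1) i n(2)[symmetric] u, of m'] by auto
  have "(\<phi> n u \<cdot> \<phi> i u) [^]\<^bsub>G\<^esub> m = \<phi> n u \<cdot> (\<phi> i u \<cdot> ev l)"
    using i n u l(4) m' nat_pow_Suc2[of "\<phi> n u \<cdot> \<phi> i u" m'] by (simp add: m_assoc)
  then show ?thesis using pq n i u l
    by (intro bexI[of _ u] bexI[of _ "(i, u) # l"]) (auto simp: reduced_words_Cons)
qed

lemma exists_cc_pow_word:
  fixes k :: int
  assumes i: "i \<in> {1..N}" and n: "n \<in> {1..N}" "i \<noteq> n" and k: "k \<noteq> 0"
    and pq: "p = i \<and> q = n \<or> p = n \<and> q = i"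
  shows "\<exists>y\<in>carrier H. \<exists>l\<in>reduced_words H {1..N}. l \<noteq> [] \<and> fst (hd l) = i \<and> set l \<subseteq> {i, n} \<times> carrier H \<and>
    cc p q [^]\<^bsub>G\<^esub> k = \<phi> n y \<cdot> ev l"
proof (cases k rule: int_cases2)
  case (nonneg m)
  then show ?thesis using exists_twist_word[OF i n h _ pq, of m] k by (simp add: cc_def int_pow_int)
next
  case (nonpos m)
  have pq': "p \<in> {1..N}" "q \<in> {1..N}" using pq i n by auto
  have "cc p q [^]\<^bsub>G\<^esub> k = ginv (cc p q) [^]\<^bsub>G\<^esub> m"
    using pq' nonpos by (simp add: int_pow_neg_int nat_pow_inv)
  \<comment> \<open>The inverse has the same shape, with \<open>p\<close> and \<open>q\<close>
    exchanged and \<open>h\<close> replaced by its inverse, so negative powers reduce to positive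
    ones.\<close>
  also have "ginv (cc p q) = \<phi> q (inv\<^bsub>H\<^esub> h) \<cdot> \<phi> p (inv\<^bsub>H\<^esub> h)"
    using pq' h by (simp add: cc_def inv_mult_group \<phi>_inv)
  finally have e: "cc p q [^]\<^bsub>G\<^esub> k = (\<phi> q (inv\<^bsub>H\<^esub> h) \<cdot> \<phi> p (inv\<^bsub>H\<^esub> h)) [^]\<^bsub>G\<^esub> m" .
  have "m > 0" "inv\<^bsub>H\<^esub> h \<in> carrier H" "inv\<^bsub>H\<^esub> h \<noteq> \<one>\<^bsub>H\<^esub>" using k nonpos h by auto
  then show ?thesis unfolding e using pq i n by (intro exists_twist_word) auto
qed

text \<open>
  The conjugator \<open>w\<close> in \<open>w\<^sup>-\<^sup>1 h\<^sub>n w\<close> is only determined up to left multiplication by elements commuting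
  with \<open>h\<^sub>n\<close>, whence the factor \<open>\<phi> n y\<close>.
\<close>

definition starts :: "nat \<Rightarrow> nat \<Rightarrow> 'a \<Rightarrow> bool" where
  "starts n i w \<longleftrightarrow> (\<exists>y\<in>carrier H. \<exists>l\<in>reduced_words H {1..N}. l \<noteq> [] \<and> fst (hd l) = i \<and> w = \<phi> n y \<cdot> ev l)"

text \<open>Undoing the outer conjugation leaves a partial conjugation \<open>\<Theta>\<close> that
  fixes copies \<open>i\<close> and \<open>n\<close>. It puts a power of the twist in front of the
  first letter of index \<open>j\<close>, and this power begins with index \<open>i\<close> after a
  factor from copy \<open>n\<close>.\<close>

lemma starts_step:
  fixes k :: int
  assumes i: "i \<in> {1..<n}" and n: "n \<le> N" and j: "j \<in> {1..<n}" "i \<noteq> j" and k: "k \<noteq> 0" and w: "starts n j w"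
  shows "starts n i (cc n i [^]\<^bsub>G\<^esub> k \<cdot> act (B.loop n i [^] k) w)"
proof -
  have ii: "i \<in> {1..N}" "n \<in> {1..N}" "i \<noteq> n" using i n by auto
  have jJ: "j \<in> {1..N} - {i, n}" using j n by auto
  note [simp] = ii(1,2)[simplified] i[simplified] n
  let ?c = "cc n i [^]\<^bsub>G\<^esub> k"
  define \<Theta> where "\<Theta> x = ?c \<cdot> act (B.loop n i [^] k) x \<cdot> ginv ?c" for x
  \<comment> \<open>The letter \<open>(n, y)\<close> may be trivial, so \<open>d\<close> itself need
    not be reduced; only its tail \<open>r\<close> is.\<close>
  have word: "\<exists>d. set d \<subseteq> {i, n} \<times> carrier H \<and> twist n i l [^]\<^bsub>G\<^esub> k = ev d \<and>
      (\<exists>y\<in>carrier H. \<exists>r\<in>reduced_words H {1..N}. r \<noteq> [] \<and> fst (hd r) = i \<and> d = (n, y) # r)"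
    if "l \<in> {1..N} - {i, n}" for l
  proof -
    have "twist n i l = cc i n \<or> twist n i l = cc n i" using that by (auto simp: twist_def)
    then obtain p q where pq: "p = i \<and> q = n \<or> p = n \<and> q = i" "twist n i l = cc p q" by blast
    obtain y r where yr: "y \<in> carrier H" "r \<in> reduced_words H {1..N}" "r \<noteq> []" "fst (hd r) = i"
      "set r \<subseteq> {i, n} \<times> carrier H" "cc p q [^]\<^bsub>G\<^esub> k = \<phi> n y \<cdot> ev r"
      using exists_cc_pow_word[OF ii k pq(1)] by blast
    show ?thesis using yr pq(2) by (intro exI[of _ "(n, y) # r"]) auto
  qed
  then have "\<forall>l\<in>{1..N} - {i, n}. \<exists>d. set d \<subseteq> {i, n} \<times> carrier H \<and> twist n i l [^]\<^bsub>G\<^esub> k = ev d \<and>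
      (\<exists>y\<in>carrier H. \<exists>r\<in>reduced_words H {1..N}. r \<noteq> [] \<and> fst (hd r) = i \<and> d = (n, y) # r)"
    by blast
  from bchoice[OF this] obtain D where D: "\<And>l. l \<in> {1..N} - {i, n} \<Longrightarrow> set (D l) \<subseteq> {i, n} \<times> carrier H"
    "\<And>l. l \<in> {1..N} - {i, n} \<Longrightarrow> twist n i l [^]\<^bsub>G\<^esub> k = ev (D l)"
    "\<And>l. l \<in> {1..N} - {i, n} \<Longrightarrow> \<exists>y\<in>carrier H. \<exists>r\<in>reduced_words H {1..N}. r \<noteq> [] \<and> fst (hd r) = i \<and> D l = (n, y) # r"
    by blast
  \<comment> \<open>The outer power of \<open>cc n i\<close> becomes the trailing factor
    \<open>z\<close> of \<open>partial_conj_reduced\<close>.\<close>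
  obtain z where z: "set z \<subseteq> {i, n} \<times> carrier H" "?c = ev z"
  proof -
    obtain y r where "y \<in> carrier H" "set r \<subseteq> {i, n} \<times> carrier H" "?c = \<phi> n y \<cdot> ev r"
      using exists_cc_pow_word[OF ii k, of n i] by blast
    then show ?thesis by (intro that[of "(n, y) # r"]) auto
  qed
  have \<Theta>_hom: "\<Theta> \<in> hom G G"
    by (rule homI) (simp_all add: \<Theta>_def m_assoc)
  have \<Theta>_val: "\<Theta> (\<phi> l y) = twist n i l [^]\<^bsub>G\<^esub> k \<cdot> \<phi> l y \<cdot> ginv (twist n i l [^]\<^bsub>G\<^esub> k)"
    if "l \<in> {1..N}" "y \<in> carrier H" for l y
    using that by (simp add: \<Theta>_def act_loop_pow m_assoc)
  have fixed: "\<Theta> (\<phi> l y) = \<phi> l y" if "l \<in> {i, n}" "y \<in> carrier H" for l y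
  proof -
    have "twist n i l = \<one>\<^bsub>G\<^esub>" "l \<in> {1..N}" using that ii by (auto simp: twist_def)
    then show ?thesis using that by (simp add: \<Theta>_val)
  qed
  obtain y l where yl: "y \<in> carrier H" "l \<in> reduced_words H {1..N}" "l \<noteq> []" "fst (hd l) = j"
    "w = \<phi> n y \<cdot> ev l" using w by (auto simp: starts_def)
  have "\<exists>r\<in>reduced_words H {1..N}. r \<noteq> [] \<and> fst (hd r) = j \<and> \<Theta> (ev l) \<cdot> ev z = ev (D j) \<cdot> ev r"
    using ii \<Theta>_hom fixed D(1) z(1) yl(2,3,4) jJ
    by (intro partial_conj_reduced[where J = "{i, n}"]) (auto simp: \<Theta>_val D(2))
  then obtain r where r: "r \<in> reduced_words H {1..N}" "r \<noteq> []" "fst (hd r) = j"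
    "\<Theta> (ev l) \<cdot> ev z = ev (D j) \<cdot> ev r" by blast
  obtain y' d where d: "y' \<in> carrier H" "d \<in> reduced_words H {1..N}" "d \<noteq> []" "fst (hd d) = i" "D j = (n, y') # d"
    using D(3)[OF jJ] by blast
  have cl: "set l \<subseteq> {1..N} \<times> carrier H" "set r \<subseteq> {1..N} \<times> carrier H" "set d \<subseteq> {1..N} \<times> carrier H"
    using yl(2) r(1) d(2) by (auto dest: reduced_words_D)
  have zc: "set z \<subseteq> {1..N} \<times> carrier H" using z(1) ii by auto
  \<comment> \<open>The twist word ends with index \<open>i\<close> or \<open>n\<close>, whereas
    \<open>r\<close> begins with \<open>j\<close>, so the two concatenate without
    cancellation.\<close>
  have "fst (last d) \<in> {i, n}"
    using D(1)[OF jJ] d(3,5) last_in_set[of d] by (cases "last d") auto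
  then have dr: "d @ r \<in> reduced_words H {1..N}"
    using d r jJ by (auto simp: reduced_words_append)
  \<comment> \<open>The power moves to the right of \<open>\<Theta> w\<close>. The factors
    \<open>\<phi> n y\<close> and \<open>\<phi> n y'\<close> then meet and merge, since
    \<open>\<Theta>\<close> fixes copy \<open>n\<close>.\<close>
  have "?c \<cdot> act (B.loop n i [^] k) w = \<Theta> w \<cdot> ?c"
    using yl cl by (simp add: \<Theta>_def m_assoc)
  also have "\<dots> = \<phi> n y \<cdot> (\<Theta> (ev l) \<cdot> ev z)"
    using yl cl zc fixed[of n y] hom_in_carrier[OF \<Theta>_hom] by (simp add: hom_mult[OF \<Theta>_hom] z(2) m_assoc)
  also have "\<dots> = \<phi> n (y \<otimes>\<^bsub>H\<^esub> y') \<cdot> ev (d @ r)"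
    using yl d cl unfolding r(4) by (simp add: \<phi>_mult m_assoc)
  finally show ?thesis
    unfolding starts_def using yl d dr by (intro bexI[of _ "y \<otimes>\<^bsub>H\<^esub> y'"] bexI[of _ "d @ r"]) auto
qed

text \<open>The index \<open>i\<close> belongs to the leftmost syllable, which acts last; it is the
  index that \<open>starts\<close> detects.\<close>

inductive syllables :: "nat \<Rightarrow> nat \<Rightarrow> 'g \<Rightarrow> bool" for n where
  single: "i \<in> {1..<n} \<Longrightarrow> k \<noteq> 0 \<Longrightarrow> syllables n i (B.loop n i [^] (k :: int))"
| step: "syllables n j f \<Longrightarrow> i \<in> {1..<n} \<Longrightarrow> i \<noteq> j \<Longrightarrow> k \<noteq> 0 \<Longrightarrow> syllables n i (B.loop n i [^] (k :: int) \<otimes> f)"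

text \<open>A power of a loop conjugates h_n by the same power of \<open>cc n i\<close>. Applying it
  after \<open>f\<close> therefore replaces the conjugator \<open>w\<close> by that power times the
  image of \<open>w\<close>, which is the element treated in \<open>starts_step\<close>.\<close>

lemma syllables_act:
  assumes "syllables n i f" "n \<le> N"
  shows "i \<in> {1..<n} \<and> f \<in> carrier B \<and>
    (\<exists>w\<in>carrier G. starts n i w \<and> act f (\<phi> n h) = ginv w \<cdot> \<phi> n h \<cdot> w)"
  using assms
proof (induction rule: syllables.induct)
  case (single i k)
  have ii: "i \<in> {1..N}" "n \<in> {1..N}" "i \<noteq> n" using single by auto
  have "twist n i n = \<one>\<^bsub>G\<^esub>" by (simp add: twist_def)
  then have "act (B.loop n i [^] k) (\<phi> n h) = ginv (cc n i [^]\<^bsub>G\<^esub> k) \<cdot> \<phi> n h \<cdot> cc n i [^]\<^bsub>G\<^esub> k"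
    using single ii h act_loop_pow[of i n n h k] by simp
  moreover have "starts n i (cc n i [^]\<^bsub>G\<^esub> k)"
    using exists_cc_pow_word[OF ii single(2), of n i] unfolding starts_def by blast
  ultimately show ?case using single ii by (intro conjI bexI[of _ "cc n i [^]\<^bsub>G\<^esub> k"]) auto
next
  case (step j f i k)
  have ii: "i \<in> {1..N}" "n \<in> {1..N}" "i \<noteq> n" using step by auto
  obtain w where w: "w \<in> carrier G" "starts n j w" "act f (\<phi> n h) = ginv w \<cdot> \<phi> n h \<cdot> w"
    and f: "f \<in> carrier B" and j: "j \<in> {1..<n}" using step by auto
  have A: "B.loop n i [^] k \<in> carrier B" using step by simp
  have "twist n i n = \<one>\<^bsub>G\<^esub>" by (simp add: twist_def)
  then have "act (B.loop n i [^] k) (\<phi> n h) = ginv (cc n i [^]\<^bsub>G\<^esub> k) \<cdot> \<phi> n h \<cdot> cc n i [^]\<^bsub>G\<^esub> k"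
    using step ii h act_loop_pow[of i n n h k] by simp
  then have "act (B.loop n i [^] k \<otimes> f) (\<phi> n h) =
      ginv (cc n i [^]\<^bsub>G\<^esub> k \<cdot> act (B.loop n i [^] k) w) \<cdot> \<phi> n h \<cdot> (cc n i [^]\<^bsub>G\<^esub> k \<cdot> act (B.loop n i [^] k) w)"
    using A f w ii h by (simp add: act_mult inv_mult_group m_assoc)
  moreover have "starts n i (cc n i [^]\<^bsub>G\<^esub> k \<cdot> act (B.loop n i [^] k) w)"
    using step j w by (intro starts_step) auto
  ultimately show ?case using step ii A f w(1)
    by (intro conjI bexI[of _ "cc n i [^]\<^bsub>G\<^esub> k \<cdot> act (B.loop n i [^] k) w"]) auto
qed

text \<open>If h_n were fixed, it would commute with \<open>w\<close>, hence with the word following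
  the harmless factor \<open>\<phi> n y\<close>, against \<open>not_commute\<close>.\<close>

lemma starts_not_fixed:
  assumes w: "starts n i w" and n: "n \<in> {1..N}" "i \<noteq> n"
  shows "ginv w \<cdot> \<phi> n h \<cdot> w \<noteq> \<phi> n h"
proof
  assume eq: "ginv w \<cdot> \<phi> n h \<cdot> w = \<phi> n h"
  obtain y l where yl: "y \<in> carrier H" "l \<in> reduced_words H {1..N}" "l \<noteq> []" "fst (hd l) = i" "w = \<phi> n y \<cdot> ev l"
    using w by (auto simp: starts_def)
  have l: "set l \<subseteq> {1..N} \<times> carrier H" using yl(2) by (rule reduced_words_D)
  note [simp] = n(1)[simplified] yl(1) l[simplified] h(1)
  have "w \<cdot> (ginv w \<cdot> \<phi> n h \<cdot> w) = w \<cdot> \<phi> n h" by (simp only: eq)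
  then have "\<phi> n h \<cdot> \<phi> n y \<cdot> ev l = \<phi> n y \<cdot> (ev l \<cdot> \<phi> n h)"
    by (simp add: yl(5) m_assoc)
  also have "\<phi> n h \<cdot> \<phi> n y = \<phi> n y \<cdot> \<phi> n h" by (rule \<phi>_h_commute) simp_all
  finally have "\<phi> n h \<cdot> ev l = ev l \<cdot> \<phi> n h" by (simp add: m_assoc)
  then show False using not_commute[of l n h] yl n h h_central by auto
qed

text \<open>Syllables of equal index merge. When their exponents cancel, the remaining tail is again
  an alternating product or the identity.\<close>

lemma syllables_mult:
  assumes "i \<in> {1..<n}" "n \<le> N" and f: "f = \<one> \<or> (\<exists>j. syllables n j f)"
  shows "B.loop n i [^] (k :: int) \<otimes> f = \<one> \<or> (\<exists>j. syllables n j (B.loop n i [^] k \<otimes> f))"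
proof (cases "k = 0")
  case True
  then show ?thesis using f assms syllables_act[of n _ f] by auto
next
  case False
  show ?thesis
    using f
  proof (elim disjE exE)
    assume "f = \<one>"
    then show ?thesis using False assms single[of i n k] by auto
  next
    fix j assume j: "syllables n j f"
    have fB: "f \<in> carrier B" using syllables_act[OF j] assms by auto
    show ?thesis
    proof (cases "i = j")
      case False
      then show ?thesis using j \<open>k \<noteq> 0\<close> assms step by blast
    next
      case True
      show ?thesis using j
      proof cases
        case (single m)
        then have "B.loop n i [^] k \<otimes> f = B.loop n i [^] (k + m)"
          using True assms by (simp add: B.int_pow_mult)
        then show ?thesis using assms syllables.single[of i n "k + m"] by (cases "k + m = 0") auto
      next
        case (step j' f' m)
        have f': "f' \<in> carrier B" using syllables_act[OF step(2)] assms by auto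
        then have "B.loop n i [^] k \<otimes> f = B.loop n i [^] (k + m) \<otimes> f'"
          using True assms step by (simp add: B.int_pow_mult B.m_assoc)
        then show ?thesis using f' step True syllables.step[of n j' f' i "k + m"]
          by (cases "k + m = 0") auto
      qed
    qed
  qed
qed

lemma push_syllables:
  assumes f: "f \<in> B.push n" and n: "n \<le> N"
  shows "f = \<one> \<or> (\<exists>j. syllables n j f)"
proof -
  define S where "S = {f. f = \<one> \<or> (\<exists>j. syllables n j f)}"
  have SB: "S \<subseteq> carrier B" using n syllables_act by (auto simp: S_def)
  have X: "B.loop n ` {1..<n} \<subseteq> carrier B" using n by auto
  have "\<forall>g\<in>S. f \<otimes> g \<in> S"
    using f unfolding B.push_def
  proof (induction rule: generate.induct)
    case one
    then show ?case using SB by auto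
  next
    case (incl x)
    then obtain i where i: "i \<in> {1..<n}" "x = B.loop n i" by auto
    then show ?case using n syllables_mult[of i n _ 1] by (simp add: S_def B.int_pow_1)
  next
    case (inv x)
    then obtain i where i: "i \<in> {1..<n}" "x = B.loop n i" by auto
    have "B.loop n i [^] (- 1 :: int) = inv (B.loop n i)"
      using i n by (simp add: B.int_pow_neg B.int_pow_1)
    then show ?case using i n syllables_mult[of i n _ "- 1"] by (simp add: S_def)
  next
    case (eng g g')
    then have "g \<in> carrier B" "g' \<in> carrier B" using B.generate_in_carrier[OF X] by auto
    then show ?case using eng SB by (auto simp: B.m_assoc)
  qed
  moreover have "\<one> \<in> S" by (simp add: S_def)
  moreover have "f \<in> carrier B" using f X B.generate_in_carrier unfolding B.push_def by blast
  ultimately have "f \<in> S" by force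
  then show ?thesis by (simp add: S_def)
qed

lemma push_faithful:
  assumes "f \<in> B.push n" "n \<in> {1..N}" "act f (\<phi> n h) = \<phi> n h"
  shows "f = \<one>"
proof (rule ccontr)
  assume "f \<noteq> \<one>"
  then obtain i where "syllables n i f" using push_syllables assms by auto
  from syllables_act[OF this] assms(2) obtain w
    where "i \<noteq> n" "starts n i w" "act f (\<phi> n h) = ginv w \<cdot> \<phi> n h \<cdot> w" by auto
  then show False using starts_not_fixed[of n i w] assms by simp
qed


section \<open>Induction on the number of strands\<close>

lemma act_sub_above:
  assumes "v \<in> B.sub m" "m \<le> N" "j \<in> {m<..N}" "y \<in> carrier H"
  shows "act v (\<phi> j y) = \<phi> j y"
  using assms(1) unfolding B.sub_def
proof (induction rule: generate.induct)
  case one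
  then show ?case using assms by (simp add: act_one)
next
  case (incl x)
  then show ?case using assms by (auto simp: act_s)
next
  case (inv x)
  then show ?case using assms by (auto simp: act_inv_s)
next
  case (eng g g')
  have "B.sub m \<subseteq> carrier B" using B.subgroup_sub[of m] assms by (simp add: subgroup.subset)
  moreover have "\<phi> j y \<in> carrier G" using assms by (intro \<phi>_closed) auto
  moreover have "g \<in> carrier B" "g' \<in> carrier B" using eng \<open>B.sub m \<subseteq> _\<close> by (auto simp: B.sub_def)
  ultimately show ?case using eng by (simp add: act_mult)
qed

text \<open>The inverse of \<open>s j\<close> carries copy \<open>j\<close> to copy
  \<open>Suc j\<close> without any conjugation, and this repeats up to copy
  \<open>n\<close>.\<close>

lemma act_rep:
  assumes "j \<in> {1..n}" "n \<in> {1..N}" "y \<in> carrier H"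
  shows "act (B.rep n j) (\<phi> j y) = \<phi> n y"
  using assms
proof (induction n j rule: B.rep.induct)
  case (1 n j)
  show ?case
  proof (cases "j < n")
    case True
    then have "act (B.rep n (Suc j)) (\<phi> (Suc j) y) = \<phi> n y" using 1 by simp
    then show ?thesis using True 1 by (simp add: B.rep_step[of j n] act_mult act_inv_s)
  next
    case False
    then have "j = n" using 1 by simp
    then show ?thesis using 1 by (simp add: act_one)
  qed
qed

text \<open>All \<open>N\<close> copies are kept during the induction on \<open>n\<close>, so the
  hypothesis applies to \<open>v\<close> inside the same group \<open>G\<close>.\<close>

lemma act_faithful_sub:
  assumes "g \<in> B.sub n" "n \<le> N" "\<And>j y. j \<in> {1..N} \<Longrightarrow> y \<in> carrier H \<Longrightarrow> act g (\<phi> j y) = \<phi> j y"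
  shows "g = \<one>"
  using assms
proof (induction n arbitrary: g)
  case 0
  then show ?case by (simp add: B.sub_def B.generate_empty)
next
  case (Suc m)
  let ?n = "Suc m"
  have n: "?n \<in> {1..N}" using Suc by auto
  obtain f v j where g: "g = f \<otimes> v \<otimes> B.rep ?n j" and f: "f \<in> B.push ?n" and v: "v \<in> B.sub m" and j: "j \<in> {1..?n}"
    using B.sub_decomposition[of g ?n] Suc by auto
  have cl [simp]: "f \<in> carrier B" "v \<in> carrier B" "B.rep ?n j \<in> carrier B"
    using subgroup.mem_carrier[OF B.subgroup_push f] subgroup.mem_carrier[OF B.subgroup_sub v] Suc j by auto
  obtain \<pi> where \<pi>: "\<pi> \<in> hom G G"
    and \<pi>': "\<And>j y. j \<in> {1..N} \<Longrightarrow> y \<in> carrier H \<Longrightarrow> \<pi> (\<phi> j y) = (if j = ?n then \<one>\<^bsub>G\<^esub> else \<phi> j y)"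
    using kill_copy[OF n] by blast
  interpret \<pi>: group_hom G G \<pi> using \<pi> by unfold_locales
  \<comment> \<open>Once copy \<open>n\<close> is killed, \<open>cc n i\<close> and
    \<open>cc i n\<close> both become h_i. The twist and the outer conjugation then cancel on copies
    other than \<open>i\<close>, and on copy \<open>i\<close> conjugation by h_i is trivial.\<close>
  have \<pi>_loop: "\<pi> (act (B.loop ?n i) x) = \<pi> x" if i: "i \<in> {1..<?n}" and x: "x \<in> carrier G" for i x
  proof -
    have ii: "i \<in> {1..N}" "B.loop ?n i \<in> carrier B" using i n by auto
    have "(\<pi> \<circ> act (B.loop ?n i)) x = \<pi> x"
    proof (rule hom_eqI[OF _ \<pi> _ x])
      show "\<pi> \<circ> act (B.loop ?n i) \<in> hom G G" using Group.hom_compose[OF act_hom[OF ii(2)] \<pi>] .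
      fix j y assume jy: "j \<in> {1..N}" "y \<in> carrier H"
      have c: "\<pi> (cc ?n i) = \<phi> i h" "\<pi> (cc i ?n) = \<phi> i h"
        using i ii n h by (auto simp: cc_def \<pi>')
      have "ginv (\<phi> j h) \<cdot> (\<phi> j y \<cdot> \<phi> j h) = \<phi> j y"
        using jy h by (simp flip: \<phi>_h_commute(1)[OF jy])
      then show "(\<pi> \<circ> act (B.loop ?n i)) (\<phi> j y) = \<pi> (\<phi> j y)"
        using i ii n jy h by (auto simp: act_loop twist_def c \<pi>' m_assoc)
    qed
    then show ?thesis by simp
  qed
  have \<pi>_push: "\<pi> (act f x) = \<pi> x" if f: "f \<in> B.push ?n" and x: "x \<in> carrier G" for f x
    using f x unfolding B.push_def
  proof (induction arbitrary: x rule: generate.induct)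
    case one
    then show ?case by (simp add: act_one)
  next
    case (incl l)
    then show ?case using \<pi>_loop by auto
  next
    case (inv l)
    then obtain i where i: "i \<in> {1..<?n}" "l = B.loop ?n i" by auto
    then have "l \<in> carrier B" using n by auto
    then show ?case using \<pi>_loop[OF i(1), of "act (inv l) x"] inv i(2) by (simp add: act_inverse)
  next
    case (eng g g')
    have "B.push ?n \<subseteq> carrier B" using B.subgroup_push[of ?n] n by (simp add: subgroup.subset)
    then have "g \<in> carrier B" "g' \<in> carrier B" using eng by (auto simp: B.push_def)
    then show ?case using eng by (simp add: act_mult)
  qed
  \<comment> \<open>Otherwise h_j would equal the image under \<open>f\<close> of h_n, since the
    representative carries h_j to h_n and \<open>v\<close> fixes h_n. Applying \<open>\<pi>\<close>
    would make h_j trivial.\<close>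
  have j_n: "j = ?n"
  proof (rule ccontr)
    assume "j \<noteq> ?n"
    have jN: "j \<in> {1..N}" using j n by auto
    have "\<phi> j h = act f (act v (act (B.rep ?n j) (\<phi> j h)))"
      using Suc.prems(3)[OF jN h(1)] jN h by (simp add: g act_mult B.m_assoc)
    also have "act v (act (B.rep ?n j) (\<phi> j h)) = \<phi> ?n h"
      using act_rep[OF j n h(1)] act_sub_above[OF v, of ?n h] n h by auto
    finally have "\<pi> (\<phi> j h) = \<pi> (\<phi> ?n h)" using \<pi>_push[OF f] n h by simp
    then have "ev [(j, h)] = \<one>\<^bsub>G\<^esub>" using \<pi>' jN n h \<open>j \<noteq> ?n\<close> by simp
    moreover have "[(j, h)] \<in> reduced_words H {1..N}" using jN h by (simp add: reduced_words_Cons)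
    ultimately show False using free by blast
  qed
  have gfv: "g = f \<otimes> v" using g j_n by simp
  have fv: "act f (act v x) = x" if x: "x \<in> carrier G" for x
  proof -
    have "act g x = (\<lambda>x. x) x"
      by (rule hom_eqI[OF _ _ _ x]) (use Suc.prems(3) in \<open>auto simp: gfv act_hom hom_def\<close>)
    then show ?thesis using x by (simp add: gfv act_mult)
  qed
  \<comment> \<open>The generators of \<open>sub m\<close> involve only copies of index at most
    \<open>m\<close>, none of which is killed, so \<open>v\<close> commutes with
    \<open>\<pi>\<close>.\<close>
  have \<pi>_sub: "\<pi> (act v x) = act v (\<pi> x)" if x: "x \<in> carrier G" for x
    using v x unfolding B.sub_def
  proof (induction arbitrary: x rule: generate.induct)
    case one
    then show ?case by (simp add: act_one)
  next
    case (incl l)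
    then obtain k where k: "l = s k" "k \<in> {1..<m}" by auto
    have sk: "s k \<in> carrier B" using k n by auto
    have "(\<pi> \<circ> act (s k)) x = (act (s k) \<circ> \<pi>) x"
      using k n sk h
      by (intro hom_eqI[OF Group.hom_compose[OF act_hom[OF sk] \<pi>] Group.hom_compose[OF \<pi> act_hom[OF sk]] _ incl(2)])
        (auto simp: act_s \<pi>')
    then show ?case using k by simp
  next
    case (inv l)
    then obtain k where k: "l = s k" "k \<in> {1..<m}" by auto
    have sk: "s k \<in> carrier B" using k n by auto
    then have sk': "inv (s k) \<in> carrier B" by simp
    have "(\<pi> \<circ> act (inv (s k))) x = (act (inv (s k)) \<circ> \<pi>) x"
      using k n sk h
      by (intro hom_eqI[OF Group.hom_compose[OF act_hom[OF sk'] \<pi>] Group.hom_compose[OF \<pi> act_hom[OF sk']] _ inv(2)])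
        (auto simp: act_inv_s \<pi>')
    then show ?case using k by simp
  next
    case (eng g g')
    have "B.sub m \<subseteq> carrier B" using B.subgroup_sub[of m] n by (simp add: subgroup.subset)
    then have "g \<in> carrier B" "g' \<in> carrier B" using eng by (auto simp: B.sub_def)
    then show ?case using eng by (simp add: act_mult)
  qed
  \<comment> \<open>Copy \<open>Suc m\<close> is out of reach of \<open>v\<close>. On every other
    copy \<open>\<pi>\<close> can be inserted: it commutes with \<open>v\<close> and absorbs
    \<open>f\<close>, and the product of \<open>f\<close> and \<open>v\<close> acts
    trivially.\<close>
  have "act v (\<phi> i y) = \<phi> i y" if iy: "i \<in> {1..N}" "y \<in> carrier H" for i y
  proof (cases "i = ?n")
    case True
    then show ?thesis using act_sub_above[OF v, of i y] iy n by auto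
  next
    case False
    have "act v (\<phi> i y) = act v (\<pi> (\<phi> i y))" using False iy by (simp add: \<pi>')
    also have "\<dots> = \<pi> (act v (\<phi> i y))" using \<pi>_sub iy by simp
    also have "\<dots> = \<pi> (act f (act v (\<phi> i y)))" using \<pi>_push[OF f] iy by simp
    also have "\<dots> = \<phi> i y" using fv iy False by (simp add: \<pi>')
    finally show ?thesis .
  qed
  then have v1: "v = \<one>" using Suc.IH[OF v] n by auto
  have "act f (\<phi> ?n h) = \<phi> ?n h" using fv[of "\<phi> ?n h"] n h by (simp add: v1 act_one)
  then have "f = \<one>" using push_faithful[OF f n] by blast
  then show ?case using gfv v1 by simp
qed

end

section \<open>Faithfulness\<close>

lemma copy_inj_word_eval:
  assumes H: "group H" and l: "set l \<subseteq> {1..n} \<times> carrier H"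
  shows "word_eval (free_power n H) (\<lambda>(i, y). copy_inj n H i y) l =
    word_class (SIGMA i:{1..n}. carrier H) (free_product_relations {1..n} (\<lambda>_. H)) l"
  using l
proof (induction l)
  case Nil
  then show ?case by (simp add: free_power_def free_product_def one_presented_monoid)
next
  case (Cons p l)
  then have "[p] \<in> lists (SIGMA i:{1..n}. carrier H)" "l \<in> lists (SIGMA i:{1..n}. carrier H)" by auto
  from mult_presented_monoid[OF this] show ?case
    using Cons by (cases p) (simp add: copy_inj_def free_product_inj_def free_power_def free_product_def)
qed

lemma carrier_braid_group_generate:
  "carrier (braid_group n) = generate (braid_group n) (braid_gen n ` {1..<n})"
proof -
  interpret group "braid_group n" by (rule group_braid_group)
  let ?W = "word_class (braid_letters n) (braid_relations n)" and ?g = "generate (braid_group n) (braid_gen n ` {1..<n})"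
  have gen: "?W [(k, b)] \<in> ?g" if k: "k \<in> {1..<n}" for k b
  proof (cases b)
    case True
    then show ?thesis using k by (auto simp: braid_gen_def intro: generate.incl)
  next
    case False
    have cl: "?W [(k, c)] \<in> carrier (braid_group n)" for c
      using k by (auto simp: braid_group_def braid_letters_def intro: word_class_closed)
    have "([(k, False), (k, \<not> False)], []) \<in> word_cong (braid_letters n) (braid_relations n)"
      using k by (intro word_cong.rel) (auto simp: braid_letters_def braid_relations_def)
    then have "?W [(k, False)] \<otimes>\<^bsub>braid_group n\<^esub> ?W [(k, True)] = \<one>\<^bsub>braid_group n\<^esub>"
      using k by (simp add: braid_group_def mult_presented_monoid one_presented_monoid
          braid_letters_def word_class_eq)
    then have "?W [(k, False)] = inv\<^bsub>braid_group n\<^esub> (braid_gen n k)"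
      using cl by (simp add: braid_gen_def inv_equality)
    then show ?thesis using k False by (auto intro: generate.inv)
  qed
  have "?W w \<in> ?g" if "w \<in> lists (braid_letters n)" for w
    using that
  proof (induction w)
    case Nil
    show ?case using generate.one[of "braid_group n"] by (simp add: braid_group_def one_presented_monoid)
  next
    case (Cons l w)
    have "?W (l # w) = ?W [l] \<otimes>\<^bsub>braid_group n\<^esub> ?W w"
      using Cons by (simp add: braid_group_def mult_presented_monoid)
    moreover have "?W [l] \<in> ?g" using Cons gen by (cases l) (auto simp: braid_letters_def)
    ultimately show ?case using Cons generate.eng by metis
  qed
  then have "carrier (braid_group n) \<subseteq> ?g"
    by (auto simp: braid_group_def carrier_presented_monoid)
  moreover have "?g \<subseteq> carrier (braid_group n)"
    by (intro generate_incl) (auto simp: braid_gen_def braid_group_def braid_letters_def intro!: word_class_closed)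
  ultimately show ?thesis by blast
qed

lemma braid_generators_braid_group: "braid_generators (braid_group n) n (braid_gen n)"
proof -
  interpret group "braid_group n" by (rule group_braid_group)
  let ?C = "word_cong (braid_letters n) (braid_relations n)"
  have L: "(k, True) \<in> braid_letters n" if "k \<in> {1..<n}" for k using that by (simp add: braid_letters_def)
  show ?thesis
  proof
    show "braid_gen n k \<in> carrier (braid_group n)" if "k \<in> {1..<n}" for k
      unfolding braid_gen_def braid_group_def using L[OF that] by (intro word_class_closed) auto
    show "braid_gen n k \<otimes>\<^bsub>braid_group n\<^esub> braid_gen n (Suc k) \<otimes>\<^bsub>braid_group n\<^esub> braid_gen n k =
        braid_gen n (Suc k) \<otimes>\<^bsub>braid_group n\<^esub> braid_gen n k \<otimes>\<^bsub>braid_group n\<^esub> braid_gen n (Suc k)"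
      if k: "k \<in> {1..<n}" "Suc k \<in> {1..<n}" for k
    proof -
      have "([(k, True), (Suc k, True), (k, True)], [(Suc k, True), (k, True), (Suc k, True)]) \<in> ?C"
        using k L by (intro word_cong.rel) (auto simp: braid_relations_def)
      then show ?thesis using L[OF k(1)] L[OF k(2)]
        by (simp add: braid_gen_def braid_group_def mult_presented_monoid word_class_eq)
    qed
    show "braid_gen n i \<otimes>\<^bsub>braid_group n\<^esub> braid_gen n j = braid_gen n j \<otimes>\<^bsub>braid_group n\<^esub> braid_gen n i"
      if ij: "i \<in> {1..<n}" "j \<in> {1..<n}" "i + 2 \<le> j" for i j
    proof -
      have "([(i, True), (j, True)], [(j, True), (i, True)]) \<in> ?C"
        using ij L by (intro word_cong.rel) (auto simp: braid_relations_def)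
      then show ?thesis using L[OF ij(1)] L[OF ij(2)]
        by (simp add: braid_gen_def braid_group_def mult_presented_monoid word_class_eq)
    qed
  qed
qed

lemma (in group) subgroup_centralizer:
  assumes "h \<in> carrier G"
  shows "subgroup {y \<in> carrier G. h \<otimes> y = y \<otimes> h} G"
proof
  fix x y assume "x \<in> {y \<in> carrier G. h \<otimes> y = y \<otimes> h}" "y \<in> {y \<in> carrier G. h \<otimes> y = y \<otimes> h}"
  then have c: "x \<in> carrier G" "y \<in> carrier G" "h \<otimes> x = x \<otimes> h" "h \<otimes> y = y \<otimes> h" by auto
  have "h \<otimes> (x \<otimes> y) = (h \<otimes> x) \<otimes> y" using c(1,2) assms by (simp add: m_assoc)
  also have "\<dots> = x \<otimes> (h \<otimes> y)" unfolding c(3) using c(1,2) assms by (simp add: m_assoc)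
  also have "\<dots> = (x \<otimes> y) \<otimes> h" unfolding c(4) using c(1,2) assms by (simp add: m_assoc)
  finally show "x \<otimes> y \<in> {y \<in> carrier G. h \<otimes> y = y \<otimes> h}" using c by simp
next
  fix x assume x: "x \<in> {y \<in> carrier G. h \<otimes> y = y \<otimes> h}"
  then show "inv x \<in> {y \<in> carrier G. h \<otimes> y = y \<otimes> h}"
    using commute_inv[of x h] assms by auto
qed (use assms in auto)

theorem proposition4p1:
  fixes H :: "('a, 'b) monoid_scheme" and h :: 'a and n :: nat
    and \<rho> :: "(nat \<times> bool) list set \<Rightarrow> (nat \<times> 'a) list set \<Rightarrow> (nat \<times> 'a) list set"
  assumes "n \<ge> 1"
    and "group H"
    and "h \<in> carrier H - {\<one>\<^bsub>H\<^esub>}"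
    and "artin_type_representation n H h \<rho>"
  shows "inj_on \<rho> (carrier (braid_group n))"
proof -
  interpret H: group H by fact
  have h: "h \<in> carrier H" "h \<noteq> \<one>\<^bsub>H\<^esub>" using assms(3) by auto
  define Gr where "Gr = free_power n H"
  interpret G: group Gr unfolding Gr_def free_power_def by (rule group_free_product) (rule assms(2))
  interpret A: group "AutoGroup Gr" by (rule G.AutoGroup)
  interpret B: group "braid_group n" by (rule group_braid_group)
  \<comment> \<open>The centralizer of \<open>h\<close>. As the factor group it makes
    \<open>h\<close> central, and it contains \<open>h\<close>, so \<open>h\<close> remains a
    nontrivial element of it.\<close>
  define C where "C = {y \<in> carrier H. h \<otimes>\<^bsub>H\<^esub> y = y \<otimes>\<^bsub>H\<^esub> h}"
  define HC where "HC = H\<lparr>carrier := C\<rparr>"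
  define \<phi> where "\<phi> = copy_inj n H"
  have Csub: "subgroup C H" unfolding C_def using h by (intro H.subgroup_centralizer)
  interpret HC: group HC unfolding HC_def using Csub by (rule H.subgroup_imp_group)
  have CH: "C \<subseteq> carrier H" and hC: "h \<in> C" using h by (auto simp: C_def)
  have \<phi>_hom: "\<phi> j \<in> hom H Gr" if "j \<in> {1..n}" for j
    unfolding \<phi>_def Gr_def using copy_inj_hom[OF assms(2) h(1) that] .
  have \<phi>_closed: "\<phi> j y \<in> carrier Gr" if "j \<in> {1..n}" "y \<in> carrier H" for j y
    using \<phi>_hom[OF that(1)] that(2) by (auto simp: hom_def)
  define X where "X = (\<Union>j\<in>{1..n}. \<phi> j ` C)"
  have X: "X \<subseteq> carrier Gr" using \<phi>_closed CH by (auto simp: X_def)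
  define S where "S = generate Gr X"
  define GS where "GS = Gr\<lparr>carrier := S\<rparr>"
  have Ssub: "subgroup S Gr" unfolding S_def using X by (rule G.generate_is_subgroup)
  interpret S: subgroup S Gr by (rule Ssub)
  interpret GS: group GS unfolding GS_def using Ssub by (rule G.subgroup_imp_group)
  have \<phi>S: "\<phi> j y \<in> S" if "j \<in> {1..n}" "y \<in> C" for j y
    unfolding S_def X_def using that by (intro generate.incl) auto
  have [simp]: "carrier GS = S" "mult GS = mult Gr" "one GS = one Gr" "carrier HC = C" "mult HC = mult H" "one HC = one H"
    by (simp_all add: GS_def HC_def)
  have invS: "inv\<^bsub>GS\<^esub> x = inv\<^bsub>Gr\<^esub> x" if "x \<in> S" for x
    unfolding GS_def using G.m_inv_consistent[OF Ssub that] by simp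
  \<comment> \<open>To restrict an endomorphism to \<open>S\<close> it is enough that the generating
    set \<open>X\<close> is sent into \<open>S\<close>.\<close>
  have homS: "\<pi> \<in> hom GS GS" if \<pi>: "\<pi> \<in> hom Gr Gr" "\<pi> ` X \<subseteq> S" for \<pi>
  proof -
    interpret \<pi>: group_hom Gr Gr \<pi> using \<pi>(1) by unfold_locales
    have "\<pi> x \<in> S" if "x \<in> S" for x
      using that unfolding S_def
    proof (induction rule: generate.induct)
      case (inv x)
      then have "x \<in> carrier Gr" "\<pi> x \<in> S" using X \<pi>(2) by auto
      then show ?case using S.m_inv_closed S_def by simp
    next
      case (eng x y)
      then have "x \<in> carrier Gr" "y \<in> carrier Gr" using S.mem_carrier S_def by auto
      then show ?case using eng S.m_closed S_def by simp
    qed (use \<pi>(2) S.one_closed S_def in auto)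
    then show ?thesis by (intro homI) auto
  qed
  have \<rho>: "\<rho> \<in> hom (braid_group n) (AutoGroup Gr)"
    and gen: "\<And>k. k \<in> {1..<n} \<Longrightarrow> is_artin_aut n H h k (\<rho> (braid_gen n k))"
    using assms(4) by (auto simp: artin_type_representation_def Gr_def)
  interpret \<rho>: group_hom "braid_group n" "AutoGroup Gr" \<rho> using \<rho> by unfold_locales
  have aut: "\<rho> g \<in> auto Gr" if "g \<in> carrier (braid_group n)" for g
    using \<rho>.hom_closed[OF that] by (simp add: carrier_AutoGroup)
  have \<rho>_hom: "\<rho> g \<in> hom Gr Gr" if "g \<in> carrier (braid_group n)" for g
    using aut[OF that] by (simp add: auto_def)
  have \<rho>_mult: "\<rho> (g \<otimes>\<^bsub>braid_group n\<^esub> g') x = \<rho> g (\<rho> g' x)"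
    if "g \<in> carrier (braid_group n)" "g' \<in> carrier (braid_group n)" "x \<in> carrier Gr" for g g' x
    using that aut by (simp add: mult_AutoGroup compose_eq)
  have \<rho>_one: "\<rho> \<one>\<^bsub>braid_group n\<^esub> x = x" if "x \<in> carrier Gr" for x
    using that by (simp add: one_AutoGroup)
  interpret BG: braid_generators "braid_group n" n "braid_gen n" by (rule braid_generators_braid_group)
  \<comment> \<open>For \<open>y\<close> in the centralizer the conjugation by h_k in the image of
    copy \<open>Suc k\<close> disappears.\<close>
  have \<rho>_s: "\<rho> (braid_gen n k) (\<phi> j y) =
      (if j = k then inv\<^bsub>Gr\<^esub> (\<phi> k h) \<otimes>\<^bsub>Gr\<^esub> \<phi> (Suc k) y \<otimes>\<^bsub>Gr\<^esub> \<phi> k h else if j = Suc k then \<phi> k y else \<phi> j y)"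
    if k: "k \<in> {1..<n}" and j: "j \<in> {1..n}" and y: "y \<in> C" for k j y
  proof -
    have kn: "k \<in> {1..n}" "Suc k \<in> {1..n}" using k by auto
    have "\<phi> k h \<otimes>\<^bsub>Gr\<^esub> \<phi> k y = \<phi> k y \<otimes>\<^bsub>Gr\<^esub> \<phi> k h"
      using y h hom_mult[OF \<phi>_hom[OF kn(1)], symmetric] by (simp add: C_def)
    then have "\<phi> k h \<otimes>\<^bsub>Gr\<^esub> \<phi> k y \<otimes>\<^bsub>Gr\<^esub> inv\<^bsub>Gr\<^esub> (\<phi> k h) = \<phi> k y"
      using \<phi>_closed[OF kn(1)] h y CH by (auto simp: G.m_assoc)
    then show ?thesis using gen[OF k] j y CH unfolding is_artin_aut_def Let_def \<phi>_def Gr_def by auto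
  qed
  have \<rho>_S: "\<rho> g \<in> hom GS GS" if "g \<in> carrier (braid_group n)" for g
    using that unfolding carrier_braid_group_generate
  proof (induction rule: generate.induct)
    case one
    show ?case by (rule homS[OF \<rho>_hom]) (use X \<rho>_one \<phi>S in \<open>auto simp: X_def\<close>)
  next
    case (incl g)
    then obtain k where k: "g = braid_gen n k" "k \<in> {1..<n}" by auto
    show ?case unfolding k(1)
      by (rule homS[OF \<rho>_hom]) (use k hC \<phi>S in \<open>auto simp: X_def \<rho>_s\<close>)
  next
    case (inv g)
    then obtain k where k: "g = braid_gen n k" "k \<in> {1..<n}" by auto
    let ?s = "braid_gen n k"
    have sB: "?s \<in> carrier (braid_group n)" using k by simp
    have kn: "k \<in> {1..n}" "Suc k \<in> {1..n}" using k by auto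
    \<comment> \<open>Inverse generators are handled by exhibiting preimages: an element of the form
      \<open>\<rho> ?s y\<close> with \<open>y\<close> in \<open>S\<close> is taken back into
      \<open>S\<close>.\<close>
    have pull: "\<rho> (inv\<^bsub>braid_group n\<^esub> ?s) x \<in> S" if "y \<in> S" "x = \<rho> ?s y" for x y
      using that \<rho>_mult[of "inv\<^bsub>braid_group n\<^esub> ?s" ?s y] sB \<rho>_one[of y] by (simp del: \<rho>.hom_inv)
    have "\<rho> (inv\<^bsub>braid_group n\<^esub> ?s) (\<phi> j y) \<in> S" if jy: "j \<in> {1..n}" "y \<in> C" for j y
    proof -
      \<comment> \<open>The preimage of \<open>\<phi> (Suc k) y\<close> under the generator; copy
        \<open>k\<close> has its preimage in copy \<open>Suc k\<close>, and the other copies are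
        fixed.\<close>
      let ?y = "\<phi> (Suc k) h \<otimes>\<^bsub>Gr\<^esub> \<phi> k y \<otimes>\<^bsub>Gr\<^esub> inv\<^bsub>Gr\<^esub> (\<phi> (Suc k) h)"
      interpret s: group_hom Gr Gr "\<rho> ?s" using \<rho>_hom[OF sB] by unfold_locales
      have c: "\<phi> k h \<in> carrier Gr" "\<phi> (Suc k) h \<in> carrier Gr" "\<phi> k y \<in> carrier Gr" "\<phi> (Suc k) y \<in> carrier Gr"
        using \<phi>_closed kn h jy CH by auto
      have "\<rho> ?s ?y = \<phi> (Suc k) y"
        using c k kn jy hC by (simp add: \<rho>_s G.m_assoc)
      moreover have "?y \<in> S" using kn jy hC \<phi>S by simp
      moreover have "\<rho> ?s (\<phi> (Suc k) y) = \<phi> k y" using k kn jy by (simp add: \<rho>_s)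
      moreover have "\<rho> ?s (\<phi> j y) = \<phi> j y" if "j \<noteq> k" "j \<noteq> Suc k" using that k jy by (simp add: \<rho>_s)
      ultimately show ?thesis
        using pull[of ?y "\<phi> j y"] pull[of "\<phi> (Suc k) y" "\<phi> j y"] pull[of "\<phi> j y" "\<phi> j y"] \<phi>S jy kn
        by (cases "j = k"; cases "j = Suc k") auto
    qed
    then show ?case unfolding k(1) by (intro homS[OF \<rho>_hom]) (use sB in \<open>auto simp: X_def\<close>)
  next
    case (eng g g')
    then have g: "g \<in> carrier (braid_group n)" "g' \<in> carrier (braid_group n)"
      by (auto simp: carrier_braid_group_generate)
    have "\<rho> g x \<in> S" "\<rho> g' x \<in> S" if "x \<in> S" for x
      using eng that by (auto simp: hom_def)
    moreover have "\<rho> g' x \<in> S" "x \<in> carrier Gr" if "x \<in> X" for x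
      using eng that X S_def by (auto simp: hom_def intro: generate.incl)
    ultimately show ?case using g by (intro homS[OF \<rho>_hom]) (auto simp: \<rho>_mult simp del: \<rho>.hom_mult)
  qed
  have ev_eq: "word_eval GS (\<lambda>(i, y). \<phi> i y) l = word_eval Gr (\<lambda>(i, y). \<phi> i y) l" for l
    by (induction l) auto
  \<comment> \<open>The action is restricted to \<open>S\<close>. A braid acting trivially on
    \<open>Gr\<close> acts trivially on \<open>S\<close>, so faithfulness on \<open>S\<close>
    suffices.\<close>
  interpret artin_action HC GS n \<phi> "braid_group n" "braid_gen n" h \<rho>
  proof
    show "\<phi> i \<in> hom HC GS" if "i \<in> {1..n}" for i
      by (rule homI) (use \<phi>S[OF that] in \<open>auto simp: hom_mult[OF \<phi>_hom[OF that]] subsetD[OF CH]\<close>)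
    show "word_eval GS (\<lambda>(i, y). \<phi> i y) l \<noteq> \<one>\<^bsub>GS\<^esub>" if l: "l \<in> reduced_words HC {1..n}" "l \<noteq> []" for l
    proof -
      let ?W = "word_class (SIGMA i:{1..n}. carrier H) (free_product_relations {1..n} (\<lambda>_. H))"
      \<comment> \<open>A reduced word with letters from the centralizer is reduced over
        \<open>H\<close> as well, so freeness is inherited from the whole free product.\<close>
      have lr: "l \<in> reduced_words H {1..n}" using l CH by (auto simp: reduced_words_def)
      have e: "word_eval GS (\<lambda>(i, y). \<phi> i y) l = ?W l"
        unfolding ev_eq unfolding \<phi>_def Gr_def by (rule copy_inj_word_eval[OF assms(2) reduced_words_D[OF lr]])
      have one: "\<one>\<^bsub>GS\<^esub> = ?W []"
        by (simp add: Gr_def free_power_def free_product_def one_presented_monoid)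
      show ?thesis unfolding e one by (rule H.reduced_word_nontrivial[OF lr l(2)])
    qed
    show "h \<in> carrier HC" "h \<noteq> \<one>\<^bsub>HC\<^esub>" using hC h by auto
    show "h \<otimes>\<^bsub>HC\<^esub> y = y \<otimes>\<^bsub>HC\<^esub> h" if "y \<in> carrier HC" for y using that by (simp add: C_def)
    show "carrier GS = generate GS (\<Union>j\<in>{1..n}. \<phi> j ` carrier HC)"
    proof -
      have "X \<subseteq> S" using \<phi>S by (auto simp: X_def)
      then have "generate Gr X = generate GS X" unfolding GS_def using G.generate_consistent[OF _ Ssub] by simp
      then show ?thesis by (simp add: S_def X_def)
    qed
    show "\<exists>\<pi>\<in>hom GS GS. \<forall>j\<in>{1..n}. \<forall>y\<in>carrier HC. \<pi> (\<phi> j y) = (if j = m then \<one>\<^bsub>GS\<^esub> else \<phi> j y)"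
      if "m \<in> {1..n}" for m
    proof -
      \<comment> \<open>The endomorphism killing copy \<open>m\<close> comes from the universal
        property: trivial on that copy, the inclusion on the others.\<close>
      have "(if j = m then (\<lambda>_. \<one>\<^bsub>Gr\<^esub>) else \<phi> j) \<in> hom H Gr" if "j \<in> {1..n}" for j
        using \<phi>_hom[OF that] by (auto simp: hom_def)
      then obtain \<pi> where \<pi>: "\<pi> \<in> hom Gr Gr" and
        \<pi>': "\<And>j y. j \<in> {1..n} \<Longrightarrow> y \<in> carrier H \<Longrightarrow> \<pi> (\<phi> j y) = (if j = m then (\<lambda>_. \<one>\<^bsub>Gr\<^esub>) else \<phi> j) y"
        using free_power_lift[OF assms(2) h(1), of n "\<lambda>j. if j = m then (\<lambda>_. \<one>\<^bsub>Gr\<^esub>) else \<phi> j"]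
        unfolding \<phi>_def Gr_def by blast
      have \<pi>'': "\<pi> (\<phi> j y) = (if j = m then \<one>\<^bsub>Gr\<^esub> else \<phi> j y)" if "j \<in> {1..n}" "y \<in> C" for j y
        using \<pi>'[of j y] that CH by auto
      then have "\<pi> \<in> hom GS GS" using \<phi>S by (intro homS \<pi>) (auto simp: X_def)
      then show ?thesis using \<pi>'' by (intro bexI[of _ \<pi>]) auto
    qed
    show "\<rho> (braid_gen n k) (\<phi> j y) = (if j = k then inv\<^bsub>GS\<^esub> \<phi> k h \<otimes>\<^bsub>GS\<^esub> \<phi> (Suc k) y \<otimes>\<^bsub>GS\<^esub> \<phi> k h
        else if j = Suc k then \<phi> k y else \<phi> j y)"
      if "k \<in> {1..<n}" "j \<in> {1..n}" "y \<in> carrier HC" for k j y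
      using that hC \<phi>S[of k h] by (simp add: \<rho>_s invS)
  qed (use \<rho>_S \<rho>_mult \<rho>_one in \<open>auto simp del: \<rho>.hom_mult \<rho>.hom_one\<close>)
  show ?thesis
    unfolding \<rho>.inj_on_one_iff
  proof (intro allI impI)
    fix g assume g: "g \<in> carrier (braid_group n)" "\<rho> g = \<one>\<^bsub>AutoGroup Gr\<^esub>"
    show "g = \<one>\<^bsub>braid_group n\<^esub>"
    proof (rule act_faithful_sub[of g n])
      show "g \<in> BG.sub n" using g carrier_braid_group_generate by (simp add: BG.sub_def)
    qed (use g \<phi>_closed CH in \<open>auto simp: one_AutoGroup\<close>)
  qed
qed

end
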